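(* Let $\{\underline f\}=\{f_1,\dots,f_r\}$ be a sequence of generators of an ideal $\mathfrak a\subseteq A$, and for each $f_i$ fix a compatible system of $p$-power roots of $f_i$ in $A_\infty$. For a positive integer $n$ let $\underline f^{\bullet n}$ be the set of degree $n$ monomials in the $f_i$, with compatible systems of $p$-power roots given by the products of the fixed compatible systems of the $f_i$. Then for all positive integers $n$ and real numbers $t\ge0$, $$\tau([\underline f^{\bullet n}]^t)=\tau([\underline f]^{nt}).$$
   Context: Fix a prime $p$. $K^\circ$ denotes the $p$-adic completion of $\mathbb Z_p[p^{1/p^\infty}]$. A $K^\circ$-algebra $S$ is integral perfectoid if it is $p$-adically complete, $p$-torsion free, and Frobenius induces an isomorphism $S/p^{1/p}\to S/p$; by convention every integral perfectoid $S$ is also assumed integrally closed in $S[1/p]$. An element $z$ of a $K^\circ$-module (or a module) is almost zero if it is annihilated by $p^{1/p^k}$ for all $k>0$; "$p^{1/p^\infty}z=0$" means $z$ is almost zero. A compatible system of $p$-power roots of $g$ in $S$ is a sequence $\{g^{1/p^e}\}_{e\ge 0}$ with $g^{1/p^0}=g$ and $(g^{1/p^{e+1}})^p=g^{1/p^e}$. A ring map $A\to S$ with $S$ a $K^\circ$-algebra is almost flat if $\operatorname{Tor}_i^A(M,S)$ is almost zero for all $A$-modules $M$ and $i>0$. $(A,\mathfrak m)$ is a complete regular local ring of mixed characteristic $(0,p)$ and dimension $d$. $A\to A_\infty$ is a fixed map to an integral perfectoid $K^\circ$-algebra such that: (a) every element of $A$ has a compatible system of $p$-power roots in $A_\infty$;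 (b) $A\to A_\infty$ is almost flat (so it is injective, and nonzero elements of $A$ are nonzerodivisors on $A_\infty$); (c) if $M$ is an $A$-module with $M\otimes_AA_\infty$ almost zero, then $M=0$. For elements $f_1,\dots,f_r\in A$ with one fixed compatible system $\{f_i^{1/p^e}\}_e$ for each $i$ (data denoted $[\underline f]=[f_1,\dots,f_r]$) and real $t\ge0$, let $0^{\diamondsuit[\underline f]^t}_{H^d_{\mathfrak m}(A)}$ be the set of $\eta\in H^d_{\mathfrak m}(A)$ such that for all $e>0$, $p^{1/p^\infty}g\eta=0$ in $H^d_{\mathfrak m}(A_\infty)$ for every product $g=\prod_{i=1}^af_{j_i}^{1/p^e}$ of the chosen roots (repetitions allowed) with integer $a\ge tp^e$. Put $\tau^\sharp([\underline f]^t)=\operatorname{Ann}_A\big(0^{\diamondsuit[\underline f]^t}_{H^d_{\mathfrak m}(A)}\big)$, and $\tau([\underline f]^t)=\tau^\sharp([\underline f]^{t+\epsilon})$ for $0<\epsilon\ll1$ (this stabilizes). *)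

theory Defs
  imports Complex_Main "HOL-Algebra.Algebra"
begin

section \<open>Modules\<close>

definition mod_hom ::
  "('a, 'c) ring_scheme \<Rightarrow> ('a, 'm) module \<Rightarrow> ('a, 'n) module \<Rightarrow> ('m \<Rightarrow> 'n) set"
  where "mod_hom R M N = {f \<in> carrier M \<rightarrow> carrier N.
     (\<forall>x\<in>carrier M. \<forall>y\<in>carrier M. f (x \<oplus>\<^bsub>M\<^esub> y) = f x \<oplus>\<^bsub>N\<^esub> f y) \<and>
     (\<forall>a\<in>carrier R. \<forall>x\<in>carrier M. f (a \<odot>\<^bsub>M\<^esub> x) = a \<odot>\<^bsub>N\<^esub> f x)}"

text \<open>The fields \<open>mult\<close> and \<open>one\<close> of a module record carry no meaning.\<close>

definition quot_module :: "('a, 'm) module \<Rightarrow> 'm set \<Rightarrow> ('a, 'm set) module"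
  where "quot_module M N =
    \<lparr>carrier = a_rcosets\<^bsub>M\<^esub> N, monoid.mult = undefined, one = undefined,
     ring.zero = N, add = set_add M,
     smult = (\<lambda>a U. \<Union>x\<in>U. N +>\<^bsub>M\<^esub> (a \<odot>\<^bsub>M\<^esub> x))\<rparr>"

definition subquotient :: "('a, 'm) module \<Rightarrow> 'm set \<Rightarrow> 'm set \<Rightarrow> ('a, 'm set) module"
  where "subquotient M Z B = quot_module (M\<lparr>carrier := Z\<rparr>) B"

definition annihilator :: "('a, 'c) ring_scheme \<Rightarrow> ('a, 'm) module \<Rightarrow> 'm set \<Rightarrow> 'a set"
  where "annihilator R M N = {a \<in> carrier R. \<forall>x\<in>N. a \<odot>\<^bsub>M\<^esub> x = \<zero>\<^bsub>M\<^esub>}"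

definition restrict_scalars ::
  "('b, 'd) ring_scheme \<Rightarrow> ('a \<Rightarrow> 'b) \<Rightarrow> ('a, 'b) module"
  where "restrict_scalars S \<phi> =
    \<lparr>carrier = carrier S, monoid.mult = monoid.mult S, one = one S,
     ring.zero = ring.zero S, add = add S,
     smult = (\<lambda>a x. \<phi> a \<otimes>\<^bsub>S\<^esub> x)\<rparr>"

text \<open>
  The lifting property is tested against the modules carried by the type \<^typ>\<open>'m\<close> of \<open>P\<close>.
  This is projectivity as soon as \<^typ>\<open>'m\<close> is infinite and at least as large as the ring:
  then a free module surjecting onto \<open>P\<close> has a copy carried by \<^typ>\<open>'m\<close>.
\<close>

definition projective_module :: "('a, 'c) ring_scheme \<Rightarrow> ('a, 'm) module \<Rightarrow> bool"
  where "projective_module R P \<longleftrightarrow> module R P \<and>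
    (\<forall>(U :: ('a, 'm) module) (Y :: ('a, 'm) module). \<forall>g h.
       module R U \<and> module R Y \<and> g \<in> mod_hom R U Y \<and> g ` carrier U = carrier Y \<and>
       h \<in> mod_hom R P Y \<longrightarrow>
       (\<exists>k\<in>mod_hom R P U. \<forall>x\<in>carrier P. g (k x) = h x))"

text \<open>
  The extension property is tested against the modules carried by the type \<^typ>\<open>'m\<close> of \<open>E\<close>.
  By Baer's criterion this is injectivity as soon as the ring itself has a copy, as a module
  over itself, carried by \<^typ>\<open>'m\<close>.
\<close>

definition injective_module :: "('a, 'c) ring_scheme \<Rightarrow> ('a, 'm) module \<Rightarrow> bool"
  where "injective_module R E \<longleftrightarrow> module R E \<and>
    (\<forall>(Y :: ('a, 'm) module). \<forall>U h.
       module R Y \<and> submodule U R Y \<and> h \<in> mod_hom R (Y\<lparr>carrier := U\<rparr>) E \<longrightarrow>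
       (\<exists>k\<in>mod_hom R Y E. \<forall>x\<in>U. k x = h x))"

section \<open>Tensor products and Tor\<close>

text \<open>
  For a ring map \<open>\<phi>: A \<rightarrow> S\<close> and an \<open>A\<close>-module \<open>M\<close>, the tensor product is the free abelian
  group on \<open>M \<times> S\<close> modulo the subgroup of bilinear and balancing relations, with \<open>S\<close> acting
  on the second factor.
\<close>

definition tensor_free ::
  "('b, 'd) ring_scheme \<Rightarrow> ('a, 'm) module \<Rightarrow> ('b, ('m \<times> 'b) \<Rightarrow>\<^sub>0 int) module"
  where "tensor_free S M =
    \<lparr>carrier = {x. Poly_Mapping.keys x \<subseteq> carrier M \<times> carrier S},
     monoid.mult = undefined, one = undefined, ring.zero = 0, add = (+),
     smult = (\<lambda>s. frag_extend (\<lambda>(m, t). frag_of (m, s \<otimes>\<^bsub>S\<^esub> t)))\<rparr>"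

inductive_set tensor_rels ::
  "('a, 'c) ring_scheme \<Rightarrow> ('b, 'd) ring_scheme \<Rightarrow> ('a \<Rightarrow> 'b) \<Rightarrow> ('a, 'm) module \<Rightarrow>
    (('m \<times> 'b) \<Rightarrow>\<^sub>0 int) set"
  for A S \<phi> M where
  zero: "0 \<in> tensor_rels A S \<phi> M"
| diff: "\<lbrakk>x \<in> tensor_rels A S \<phi> M; y \<in> tensor_rels A S \<phi> M\<rbrakk> \<Longrightarrow> x - y \<in> tensor_rels A S \<phi> M"
| add_left: "\<lbrakk>m \<in> carrier M; m' \<in> carrier M; s \<in> carrier S\<rbrakk> \<Longrightarrow>
    frag_of (m \<oplus>\<^bsub>M\<^esub> m', s) - frag_of (m, s) - frag_of (m', s) \<in> tensor_rels A S \<phi> M"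
| add_right: "\<lbrakk>m \<in> carrier M; s \<in> carrier S; s' \<in> carrier S\<rbrakk> \<Longrightarrow>
    frag_of (m, s \<oplus>\<^bsub>S\<^esub> s') - frag_of (m, s) - frag_of (m, s') \<in> tensor_rels A S \<phi> M"
| balanced: "\<lbrakk>a \<in> carrier A; m \<in> carrier M; s \<in> carrier S\<rbrakk> \<Longrightarrow>
    frag_of (a \<odot>\<^bsub>M\<^esub> m, s) - frag_of (m, \<phi> a \<otimes>\<^bsub>S\<^esub> s) \<in> tensor_rels A S \<phi> M"

definition tensor ::
  "('a, 'c) ring_scheme \<Rightarrow> ('b, 'd) ring_scheme \<Rightarrow> ('a \<Rightarrow> 'b) \<Rightarrow> ('a, 'm) module \<Rightarrow>
    ('b, (('m \<times> 'b) \<Rightarrow>\<^sub>0 int) set) module"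
  where "tensor A S \<phi> M = quot_module (tensor_free S M) (tensor_rels A S \<phi> M)"

text \<open>The map \<open>f \<otimes> S\<close>, for an \<open>A\<close>-linear map \<open>f\<close> with target \<open>N\<close>.\<close>

definition tensor_map ::
  "('a, 'c) ring_scheme \<Rightarrow> ('b, 'd) ring_scheme \<Rightarrow> ('a \<Rightarrow> 'b) \<Rightarrow> ('a, 'n) module \<Rightarrow>
    ('m \<Rightarrow> 'n) \<Rightarrow> (('m \<times> 'b) \<Rightarrow>\<^sub>0 int) set \<Rightarrow> (('n \<times> 'b) \<Rightarrow>\<^sub>0 int) set"
  where "tensor_map A S \<phi> N f U =
    (\<Union>x\<in>U. tensor_rels A S \<phi> N +>\<^bsub>tensor_free S N\<^esub> frag_extend (\<lambda>(m, s). frag_of (f m, s)) x)"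

definition projective_resolution ::
  "('a, 'c) ring_scheme \<Rightarrow> ('a, 'm) module \<Rightarrow> (nat \<Rightarrow> ('a, 'i) module) \<Rightarrow> (nat \<Rightarrow> 'i \<Rightarrow> 'i) \<Rightarrow>
    ('i \<Rightarrow> 'm) \<Rightarrow> bool"
  where "projective_resolution A M P \<delta> \<epsilon> \<longleftrightarrow>
    (\<forall>n. projective_module A (P n)) \<and>
    (\<forall>n. \<delta> n \<in> mod_hom A (P (Suc n)) (P n)) \<and>
    \<epsilon> \<in> mod_hom A (P 0) M \<and> \<epsilon> ` carrier (P 0) = carrier M \<and>
    {x \<in> carrier (P 0). \<epsilon> x = \<zero>\<^bsub>M\<^esub>} = \<delta> 0 ` carrier (P 1) \<and>
    (\<forall>n. {x \<in> carrier (P (Suc n)). \<delta> n x = \<zero>\<^bsub>P n\<^esub>} = \<delta> (Suc n) ` carrier (P (Suc (Suc n))))"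

text \<open>\<open>Tor\<^sub>i\<^sup>A(M, S)\<close> computed from a projective resolution \<open>(P, \<delta>)\<close> of \<open>M\<close>.\<close>

definition tor ::
  "('a, 'c) ring_scheme \<Rightarrow> ('b, 'd) ring_scheme \<Rightarrow> ('a \<Rightarrow> 'b) \<Rightarrow> (nat \<Rightarrow> ('a, 'i) module) \<Rightarrow>
    (nat \<Rightarrow> 'i \<Rightarrow> 'i) \<Rightarrow> nat \<Rightarrow> ('b, (('i \<times> 'b) \<Rightarrow>\<^sub>0 int) set set) module"
  where "tor A S \<phi> P \<delta> i = subquotient (tensor A S \<phi> (P i))
    {z \<in> carrier (tensor A S \<phi> (P i)).
       i > 0 \<longrightarrow> tensor_map A S \<phi> (P (i - 1)) (\<delta> (i - 1)) z = \<zero>\<^bsub>tensor A S \<phi> (P (i - 1))\<^esub>}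
    (tensor_map A S \<phi> (P i) (\<delta> i) ` carrier (tensor A S \<phi> (P (Suc i))))"

section \<open>Rings\<close>

definition nat_elt :: "('a, 'c) ring_scheme \<Rightarrow> nat \<Rightarrow> 'a"
  where "nat_elt R k = [k] \<cdot>\<^bsub>R\<^esub> \<one>\<^bsub>R\<^esub>"

definition has_char :: "('a, 'c) ring_scheme \<Rightarrow> nat \<Rightarrow> bool"
  where "has_char R c \<longleftrightarrow> (\<forall>k. nat_elt R k = \<zero>\<^bsub>R\<^esub> \<longleftrightarrow> c dvd k)"

fun ideal_pow :: "('a, 'c) ring_scheme \<Rightarrow> 'a set \<Rightarrow> nat \<Rightarrow> 'a set"
  where
    "ideal_pow R I 0 = carrier R"
  | "ideal_pow R I (Suc k) = ideal_prod R (ideal_pow R I k) I"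

text \<open>
  The limit of the rings \<open>R/F\<^sub>n\<close> for a decreasing sequence of ideals; a coset of \<open>F\<^sub>n\<^sub>+\<^sub>1\<close> is
  mapped to a coset of \<open>F\<^sub>n\<close> iff it is contained in it.
\<close>

definition limit_ring :: "('a, 'c) ring_scheme \<Rightarrow> (nat \<Rightarrow> 'a set) \<Rightarrow> (nat \<Rightarrow> 'a set) ring"
  where "limit_ring R F =
    \<lparr>carrier = {s. \<forall>k. s k \<in> carrier (R Quot F k) \<and> s (Suc k) \<subseteq> s k},
     monoid.mult = (\<lambda>s t k. s k \<otimes>\<^bsub>R Quot F k\<^esub> t k),
     one = (\<lambda>k. \<one>\<^bsub>R Quot F k\<^esub>),
     ring.zero = (\<lambda>k. \<zero>\<^bsub>R Quot F k\<^esub>),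
     add = (\<lambda>s t k. s k \<oplus>\<^bsub>R Quot F k\<^esub> t k)\<rparr>"

definition complete_wrt :: "('a, 'c) ring_scheme \<Rightarrow> (nat \<Rightarrow> 'a set) \<Rightarrow> bool"
  where "complete_wrt R F \<longleftrightarrow>
    bij_betw (\<lambda>x k. F k +>\<^bsub>R\<^esub> x) (carrier R) (carrier (limit_ring R F))"

definition p_filtration :: "nat \<Rightarrow> ('a, 'c) ring_scheme \<Rightarrow> nat \<Rightarrow> 'a set"
  where "p_filtration p R k = Idl\<^bsub>R\<^esub> {nat_elt R (p ^ k)}"

definition local_ring :: "('a, 'c) ring_scheme \<Rightarrow> 'a set \<Rightarrow> bool"
  where "local_ring R m \<longleftrightarrow> cring R \<and> maximalideal m R \<and> (\<forall>m'. maximalideal m' R \<longrightarrow> m' = m)"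

definition prime_chain :: "('a, 'c) ring_scheme \<Rightarrow> (nat \<Rightarrow> 'a set) \<Rightarrow> nat \<Rightarrow> bool"
  where "prime_chain R C l \<longleftrightarrow> (\<forall>i\<le>l. primeideal (C i) R) \<and> (\<forall>i<l. C i \<subset> C (Suc i))"

definition krull_dim :: "('a, 'c) ring_scheme \<Rightarrow> nat \<Rightarrow> bool"
  where "krull_dim R d \<longleftrightarrow> (\<exists>C. prime_chain R C d) \<and> (\<forall>C l. prime_chain R C l \<longrightarrow> l \<le> d)"

definition regular_local_ring :: "('a, 'c) ring_scheme \<Rightarrow> 'a set \<Rightarrow> nat \<Rightarrow> bool"
  where "regular_local_ring R m d \<longleftrightarrow> noetherian_ring R \<and> local_ring R m \<and> krull_dim R d \<and>
    (\<exists>U\<subseteq>carrier R. finite U \<and> card U = d \<and> m = Idl\<^bsub>R\<^esub> U)"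

definition complete_regular_local_mixed ::
  "nat \<Rightarrow> ('a, 'c) ring_scheme \<Rightarrow> 'a set \<Rightarrow> nat \<Rightarrow> bool"
  where "complete_regular_local_mixed p A m d \<longleftrightarrow> regular_local_ring A m d \<and>
    complete_wrt A (ideal_pow A m) \<and> has_char A 0 \<and> has_char (A Quot m) p"

section \<open>The base ring\<close>

definition zp_ring :: "nat \<Rightarrow> (nat \<Rightarrow> int set) ring"
  where "zp_ring p = limit_ring \<Z> (p_filtration p \<Z>)"

text \<open>The monoid ring \<open>R[T\<^bsup>1/p\<^sup>\<infinity>\<^esup>]\<close>, with monomials \<open>T\<^sup>q\<close> for \<open>q \<ge> 0\<close> in \<open>\<int>[1/p]\<close>.\<close>

definition perf_exponents :: "nat \<Rightarrow> rat set"
  where "perf_exponents p = {of_nat a / of_nat (p ^ e) | a e. True}"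

definition perf_poly_ring :: "nat \<Rightarrow> ('a, 'c) ring_scheme \<Rightarrow> (rat \<Rightarrow> 'a) ring"
  where "perf_poly_ring p R =
    \<lparr>carrier = {f. (\<forall>q. f q \<in> carrier R) \<and> finite {q. f q \<noteq> \<zero>\<^bsub>R\<^esub>} \<and>
                  {q. f q \<noteq> \<zero>\<^bsub>R\<^esub>} \<subseteq> perf_exponents p},
     monoid.mult = (\<lambda>f g q. \<Oplus>\<^bsub>R\<^esub>x\<in>{x. f x \<noteq> \<zero>\<^bsub>R\<^esub> \<and> g (q - x) \<noteq> \<zero>\<^bsub>R\<^esub>}. f x \<otimes>\<^bsub>R\<^esub> g (q - x)),
     one = (\<lambda>q. if q = 0 then \<one>\<^bsub>R\<^esub> else \<zero>\<^bsub>R\<^esub>),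
     ring.zero = (\<lambda>q. \<zero>\<^bsub>R\<^esub>),
     add = (\<lambda>f g q. f q \<oplus>\<^bsub>R\<^esub> g q)\<rparr>"

definition perf_monom :: "('a, 'c) ring_scheme \<Rightarrow> rat \<Rightarrow> rat \<Rightarrow> 'a"
  where "perf_monom R q = (\<lambda>x. if x = q then \<one>\<^bsub>R\<^esub> else \<zero>\<^bsub>R\<^esub>)"

text \<open>
  \<open>\<int>\<^sub>p[p\<^bsup>1/p\<^sup>\<infinity>\<^esup>] = \<int>\<^sub>p[T\<^bsup>1/p\<^sup>\<infinity>\<^esup>]/(T - p)\<close>: this is the union over \<open>e\<close> of the rings
  \<open>\<int>\<^sub>p[X]/(X\<^bsup>p\<^sup>e\<^esup> - p)\<close>, whose defining polynomials are Eisenstein.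
\<close>

definition zp_roots_ideal :: "nat \<Rightarrow> (rat \<Rightarrow> nat \<Rightarrow> int set) set"
  where "zp_roots_ideal p = (let B = perf_poly_ring p (zp_ring p) in
    Idl\<^bsub>B\<^esub> {perf_monom (zp_ring p) 1 \<ominus>\<^bsub>B\<^esub> nat_elt B p})"

definition zp_roots_ring :: "nat \<Rightarrow> (rat \<Rightarrow> nat \<Rightarrow> int set) set ring"
  where "zp_roots_ring p = perf_poly_ring p (zp_ring p) Quot zp_roots_ideal p"

definition zp_root :: "nat \<Rightarrow> nat \<Rightarrow> (rat \<Rightarrow> nat \<Rightarrow> int set) set"
  where "zp_root p k = zp_roots_ideal p +>\<^bsub>perf_poly_ring p (zp_ring p)\<^esub>
    perf_monom (zp_ring p) (1 / of_nat (p ^ k))"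

type_synonym k_circ_elt = "nat \<Rightarrow> (rat \<Rightarrow> nat \<Rightarrow> int set) set set"

definition k_circ :: "nat \<Rightarrow> k_circ_elt ring"
  where "k_circ p = limit_ring (zp_roots_ring p) (p_filtration p (zp_roots_ring p))"

text \<open>The element \<open>p\<^bsup>1/p\<^sup>k\<^esup>\<close> of \<open>K\<^sup>\<circ>\<close>.\<close>

definition p_root :: "nat \<Rightarrow> nat \<Rightarrow> k_circ_elt"
  where "p_root p k = (\<lambda>l. p_filtration p (zp_roots_ring p) l +>\<^bsub>zp_roots_ring p\<^esub> zp_root p k)"

section \<open>Perfectoid algebras and almost mathematics\<close>

text \<open>\<open>S[1/g]\<close>, presented as \<open>S[X]/(gX - 1)\<close>, and the canonical map from \<open>S\<close>.\<close>

definition inverting_ideal :: "('b, 'd) ring_scheme \<Rightarrow> 'b \<Rightarrow> (nat \<Rightarrow> 'b) set"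
  where "inverting_ideal S g = Idl\<^bsub>UP S\<^esub> {up_ring.monom (UP S) g 1 \<ominus>\<^bsub>UP S\<^esub> \<one>\<^bsub>UP S\<^esub>}"

definition localize :: "('b, 'd) ring_scheme \<Rightarrow> 'b \<Rightarrow> (nat \<Rightarrow> 'b) set ring"
  where "localize S g = UP S Quot inverting_ideal S g"

definition to_localize :: "('b, 'd) ring_scheme \<Rightarrow> 'b \<Rightarrow> 'b \<Rightarrow> (nat \<Rightarrow> 'b) set"
  where "to_localize S g s = inverting_ideal S g +>\<^bsub>UP S\<^esub> up_ring.monom (UP S) s 0"

definition integrally_closed_in_localize :: "('b, 'd) ring_scheme \<Rightarrow> 'b \<Rightarrow> bool"
  where "integrally_closed_in_localize S g \<longleftrightarrow> (let L = localize S g in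
    \<forall>y\<in>carrier L.
      (\<exists>n c. n > (0::nat) \<and> c \<in> {..<n} \<rightarrow> carrier S \<and>
         y [^]\<^bsub>L\<^esub> n \<oplus>\<^bsub>L\<^esub> (\<Oplus>\<^bsub>L\<^esub>i\<in>{..<n}. to_localize S g (c i) \<otimes>\<^bsub>L\<^esub> y [^]\<^bsub>L\<^esub> i) = \<zero>\<^bsub>L\<^esub>)
      \<longrightarrow> y \<in> to_localize S g ` carrier S)"

definition frobenius_iso :: "nat \<Rightarrow> ('b, 'd) ring_scheme \<Rightarrow> 'b \<Rightarrow> bool"
  where "frobenius_iso p S \<pi> \<longleftrightarrow>
    (\<exists>F\<in>ring_iso (S Quot (Idl\<^bsub>S\<^esub> {\<pi>})) (S Quot (Idl\<^bsub>S\<^esub> {nat_elt S p})).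
       \<forall>x\<in>carrier S. F ((Idl\<^bsub>S\<^esub> {\<pi>}) +>\<^bsub>S\<^esub> x) = (Idl\<^bsub>S\<^esub> {nat_elt S p}) +>\<^bsub>S\<^esub> (x [^]\<^bsub>S\<^esub> p))"

text \<open>A \<open>K\<^sup>\<circ>\<close>-algebra is a commutative ring \<open>S\<close> with a structure map \<open>\<kappa>: K\<^sup>\<circ> \<rightarrow> S\<close>.\<close>

definition integral_perfectoid ::
  "nat \<Rightarrow> ('b, 'd) ring_scheme \<Rightarrow> (k_circ_elt \<Rightarrow> 'b) \<Rightarrow> bool"
  where "integral_perfectoid p S \<kappa> \<longleftrightarrow>
    cring S \<and> \<kappa> \<in> ring_hom (k_circ p) S \<and>
    complete_wrt S (p_filtration p S) \<and>
    (\<forall>x\<in>carrier S. nat_elt S p \<otimes>\<^bsub>S\<^esub> x = \<zero>\<^bsub>S\<^esub> \<longrightarrow> x = \<zero>\<^bsub>S\<^esub>) \<and>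
    frobenius_iso p S (\<kappa> (p_root p 1)) \<and>
    integrally_closed_in_localize S (nat_elt S p)"

text \<open>Almost zero elements of an \<open>S\<close>-module, regarded as a \<open>K\<^sup>\<circ>\<close>-module through \<open>\<kappa>\<close>.\<close>

definition almost_zero_elt :: "nat \<Rightarrow> (k_circ_elt \<Rightarrow> 'b) \<Rightarrow> ('b, 'n) module \<Rightarrow> 'n \<Rightarrow> bool"
  where "almost_zero_elt p \<kappa> N z \<longleftrightarrow> (\<forall>k>0. \<kappa> (p_root p k) \<odot>\<^bsub>N\<^esub> z = \<zero>\<^bsub>N\<^esub>)"

definition almost_zero :: "nat \<Rightarrow> (k_circ_elt \<Rightarrow> 'b) \<Rightarrow> ('b, 'n) module \<Rightarrow> bool"
  where "almost_zero p \<kappa> N \<longleftrightarrow> (\<forall>z\<in>carrier N. almost_zero_elt p \<kappa> N z)"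

text \<open>
  Modules over a ring with elements in \<^typ>\<open>'a\<close> are quantified over in the universe below. It
  carries copies of all countably generated modules (their elements are cosets in a free module
  \<open>A\<^bsup>(\<nat>)\<^esup>\<close>) and, when the ring is infinite, projective resolutions of all modules
  carried by it. Nothing is lost thereby: Tor commutes with filtered colimits in \<open>M\<close>, so if
  \<open>Tor\<^sub>i\<^sup>A(M, S)\<close> is almost zero for all finitely generated \<open>M\<close>, it is so for all \<open>M\<close>; and if
  \<open>S\<close> is almost flat and \<open>M \<otimes> S\<close> is almost zero, then so is \<open>N \<otimes> S\<close> for every cyclic
  submodule \<open>N\<close> of \<open>M\<close>.
\<close>

type_synonym 'a module_univ = "(nat \<Rightarrow> 'a) set"

definition almost_flat ::
  "nat \<Rightarrow> ('a, 'c) ring_scheme \<Rightarrow> ('b, 'd) ring_scheme \<Rightarrow> (k_circ_elt \<Rightarrow> 'b) \<Rightarrow> ('a \<Rightarrow> 'b) \<Rightarrow> bool"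
  where "almost_flat p A S \<kappa> \<phi> \<longleftrightarrow>
    (\<forall>(M :: ('a, 'a module_univ) module) (P :: nat \<Rightarrow> ('a, 'a module_univ) module) \<delta> \<epsilon>.
       module A M \<and> projective_resolution A M P \<delta> \<epsilon> \<longrightarrow>
       (\<forall>i>0. almost_zero p \<kappa> (tor A S \<phi> P \<delta> i)))"

definition almost_faithful ::
  "nat \<Rightarrow> ('a, 'c) ring_scheme \<Rightarrow> ('b, 'd) ring_scheme \<Rightarrow> (k_circ_elt \<Rightarrow> 'b) \<Rightarrow> ('a \<Rightarrow> 'b) \<Rightarrow> bool"
  where "almost_faithful p A S \<kappa> \<phi> \<longleftrightarrow>
    (\<forall>(M :: ('a, 'a module_univ) module).
       module A M \<and> almost_zero p \<kappa> (tensor A S \<phi> M) \<longrightarrow> carrier M = {\<zero>\<^bsub>M\<^esub>})"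

definition compatible_roots ::
  "nat \<Rightarrow> ('b, 'd) ring_scheme \<Rightarrow> 'b \<Rightarrow> (nat \<Rightarrow> 'b) \<Rightarrow> bool"
  where "compatible_roots p S g \<rho> \<longleftrightarrow>
    (\<forall>e. \<rho> e \<in> carrier S) \<and> \<rho> 0 = g \<and> (\<forall>e. \<rho> (Suc e) [^]\<^bsub>S\<^esub> p = \<rho> e)"

section \<open>Local cohomology\<close>

record ('a, 'm, 'i) coresolution =
  term_at :: "nat \<Rightarrow> ('a, 'i) module"
  diff_at :: "nat \<Rightarrow> 'i \<Rightarrow> 'i"
  aug :: "'m \<Rightarrow> 'i"

definition injective_resolution ::
  "('a, 'c) ring_scheme \<Rightarrow> ('a, 'm) module \<Rightarrow> ('a, 'm, 'i) coresolution \<Rightarrow> bool"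
  where "injective_resolution A M I \<longleftrightarrow>
    (\<forall>n. injective_module A (term_at I n)) \<and>
    (\<forall>n. diff_at I n \<in> mod_hom A (term_at I n) (term_at I (Suc n))) \<and>
    aug I \<in> mod_hom A M (term_at I 0) \<and> inj_on (aug I) (carrier M) \<and>
    {x \<in> carrier (term_at I 0). diff_at I 0 x = \<zero>\<^bsub>term_at I 1\<^esub>} = aug I ` carrier M \<and>
    (\<forall>n. {x \<in> carrier (term_at I (Suc n)). diff_at I (Suc n) x = \<zero>\<^bsub>term_at I (Suc (Suc n))\<^esub>}
       = diff_at I n ` carrier (term_at I n))"

definition torsion :: "('a, 'c) ring_scheme \<Rightarrow> 'a set \<Rightarrow> ('a, 'i) module \<Rightarrow> 'i set"
  where "torsion A m E =
    {x \<in> carrier E. \<exists>k. \<forall>a\<in>ideal_pow A m k. a \<odot>\<^bsub>E\<^esub> x = \<zero>\<^bsub>E\<^esub>}"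

definition lc_cycles ::
  "('a, 'c) ring_scheme \<Rightarrow> 'a set \<Rightarrow> ('a, 'm, 'i) coresolution \<Rightarrow> nat \<Rightarrow> 'i set"
  where "lc_cycles A m I i =
    {x \<in> torsion A m (term_at I i). diff_at I i x = \<zero>\<^bsub>term_at I (Suc i)\<^esub>}"

definition lc_boundaries ::
  "('a, 'c) ring_scheme \<Rightarrow> 'a set \<Rightarrow> ('a, 'm, 'i) coresolution \<Rightarrow> nat \<Rightarrow> 'i set"
  where "lc_boundaries A m I i = (case i of
      0 \<Rightarrow> {\<zero>\<^bsub>term_at I 0\<^esub>}
    | Suc j \<Rightarrow> diff_at I j ` torsion A m (term_at I j))"

text \<open>
  \<open>H\<^sup>i\<^sub>m(M)\<close> as the right derived functor of \<open>m\<close>-torsion, computed from an injective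
  resolution \<open>I\<close> of the \<open>A\<close>-module \<open>M\<close>.
\<close>

definition local_cohomology ::
  "('a, 'c) ring_scheme \<Rightarrow> 'a set \<Rightarrow> ('a, 'm, 'i) coresolution \<Rightarrow> nat \<Rightarrow> ('a, 'i set) module"
  where "local_cohomology A m I i =
    subquotient (term_at I i) (lc_cycles A m I i) (lc_boundaries A m I i)"

definition chain_lift ::
  "('a, 'c) ring_scheme \<Rightarrow> ('a, 'm) module \<Rightarrow> ('a, 'm, 'i) coresolution \<Rightarrow>
    ('a, 'n, 'j) coresolution \<Rightarrow> ('m \<Rightarrow> 'n) \<Rightarrow> (nat \<Rightarrow> 'i \<Rightarrow> 'j) \<Rightarrow> bool"
  where "chain_lift A M I J f F \<longleftrightarrow>
    (\<forall>n. F n \<in> mod_hom A (term_at I n) (term_at J n)) \<and>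
    (\<forall>n. \<forall>x\<in>carrier (term_at I n). F (Suc n) (diff_at I n x) = diff_at J n (F n x)) \<and>
    (\<forall>x\<in>carrier M. F 0 (aug I x) = aug J (f x))"

text \<open>
  The map \<open>H\<^sup>i\<^sub>m(f)\<close> induced by an \<open>A\<close>-linear map \<open>f: M \<rightarrow> N\<close>, where \<open>I\<close> and \<open>J\<close> resolve
  \<open>M\<close> and \<open>N\<close>. It does not depend on the chosen lift, by the comparison theorem. The lift
  exists when the terms of \<open>J\<close> are tested for injectivity in the type carrying \<open>I\<close>, hence when
  \<open>I\<close> and \<open>J\<close> are carried by the same type.
\<close>

definition lc_map ::
  "('a, 'c) ring_scheme \<Rightarrow> 'a set \<Rightarrow> ('a, 'm) module \<Rightarrow> ('a, 'm, 'i) coresolution \<Rightarrow>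
    ('a, 'n, 'j) coresolution \<Rightarrow> nat \<Rightarrow> ('m \<Rightarrow> 'n) \<Rightarrow> 'i set \<Rightarrow> 'j set"
  where "lc_map A m M I J i f \<zeta> =
    (\<Union>z\<in>\<zeta>. lc_boundaries A m J i +>\<^bsub>term_at J i\<^esub> (SOME F. chain_lift A M I J f F) i z)"

text \<open>
  \<open>H\<^sup>i\<^sub>m(S)\<close> for an \<open>A\<close>-algebra \<open>S\<close>, with its \<open>S\<close>-module structure: \<open>s\<close> acts as
  \<open>H\<^sup>i\<^sub>m\<close> of multiplication by \<open>s\<close>. Here \<open>J\<close> resolves \<open>S\<close> as an \<open>A\<close>-module.
\<close>

definition local_cohomology_alg ::
  "('a, 'c) ring_scheme \<Rightarrow> 'a set \<Rightarrow> ('b, 'd) ring_scheme \<Rightarrow> ('a \<Rightarrow> 'b) \<Rightarrow>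
    ('a, 'b, 'j) coresolution \<Rightarrow> nat \<Rightarrow> ('b, 'j set) module"
  where "local_cohomology_alg A m S \<phi> J i = (let H = local_cohomology A m J i in
    \<lparr>carrier = carrier H, monoid.mult = undefined, one = undefined,
     ring.zero = ring.zero H, add = add H,
     smult = (\<lambda>s. lc_map A m (restrict_scalars S \<phi>) J J i (\<lambda>x. s \<otimes>\<^bsub>S\<^esub> x))\<rparr>)"

section \<open>Perfectoid test ideals\<close>

text \<open>
  The data \<open>[f]\<^sup>t\<close> enter only through the family \<open>\<rho>\<close> of chosen roots, indexed by \<open>\<Lambda>\<close>:
  \<open>\<rho> \<lambda> e\<close> is the chosen \<open>p\<^sup>e\<close>-th root of \<open>f\<^sub>\<lambda>\<close>.
\<close>

definition diamond_zero ::
  "nat \<Rightarrow> ('a, 'c) ring_scheme \<Rightarrow> 'a set \<Rightarrow> nat \<Rightarrow> ('b, 'd) ring_scheme \<Rightarrow> (k_circ_elt \<Rightarrow> 'b) \<Rightarrow>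
    ('a \<Rightarrow> 'b) \<Rightarrow> ('a, 'a, 'i) coresolution \<Rightarrow> ('a, 'b, 'j) coresolution \<Rightarrow>
    'l set \<Rightarrow> ('l \<Rightarrow> nat \<Rightarrow> 'b) \<Rightarrow> real \<Rightarrow> 'i set set"
  where "diamond_zero p A m d S \<kappa> \<phi> I J \<Lambda> \<rho> t =
    (let H = local_cohomology_alg A m S \<phi> J d;
         h = lc_map A m (restrict_scalars A id) I J d \<phi>
     in {\<eta> \<in> carrier (local_cohomology A m I d).
          \<forall>e>0. \<forall>a::nat. \<forall>j\<in>{1..a} \<rightarrow> \<Lambda>. real a \<ge> t * real p ^ e \<longrightarrow>
            almost_zero_elt p \<kappa> H
              ((\<Otimes>\<^bsub>S\<^esub>i\<in>{1..a}. \<rho> (j i) e) \<odot>\<^bsub>H\<^esub> h \<eta>)})"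

definition tau_sharp ::
  "nat \<Rightarrow> ('a, 'c) ring_scheme \<Rightarrow> 'a set \<Rightarrow> nat \<Rightarrow> ('b, 'd) ring_scheme \<Rightarrow> (k_circ_elt \<Rightarrow> 'b) \<Rightarrow>
    ('a \<Rightarrow> 'b) \<Rightarrow> ('a, 'a, 'i) coresolution \<Rightarrow> ('a, 'b, 'j) coresolution \<Rightarrow>
    'l set \<Rightarrow> ('l \<Rightarrow> nat \<Rightarrow> 'b) \<Rightarrow> real \<Rightarrow> 'a set"
  where "tau_sharp p A m d S \<kappa> \<phi> I J \<Lambda> \<rho> t =
    annihilator A (local_cohomology A m I d) (diamond_zero p A m d S \<kappa> \<phi> I J \<Lambda> \<rho> t)"

definition tau ::
  "nat \<Rightarrow> ('a, 'c) ring_scheme \<Rightarrow> 'a set \<Rightarrow> nat \<Rightarrow> ('b, 'd) ring_scheme \<Rightarrow> (k_circ_elt \<Rightarrow> 'b) \<Rightarrow>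
    ('a \<Rightarrow> 'b) \<Rightarrow> ('a, 'a, 'i) coresolution \<Rightarrow> ('a, 'b, 'j) coresolution \<Rightarrow>
    'l set \<Rightarrow> ('l \<Rightarrow> nat \<Rightarrow> 'b) \<Rightarrow> real \<Rightarrow> 'a set"
  where "tau p A m d S \<kappa> \<phi> I J \<Lambda> \<rho> t =
    (THE b. \<exists>\<epsilon>\<^sub>0>0. \<forall>\<epsilon>. 0 < \<epsilon> \<and> \<epsilon> < \<epsilon>\<^sub>0 \<longrightarrow> tau_sharp p A m d S \<kappa> \<phi> I J \<Lambda> \<rho> (t + \<epsilon>) = b)"

text \<open>Degree \<open>n\<close> monomials in \<open>f\<^sub>1, \<dots>, f\<^sub>r\<close> are indexed by their exponent vectors.\<close>

definition monomial_exponents :: "nat \<Rightarrow> nat \<Rightarrow> (nat \<Rightarrow> nat) set"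
  where "monomial_exponents r n =
    {\<alpha>. (\<forall>i. i \<notin> {1..r} \<longrightarrow> \<alpha> i = 0) \<and> (\<Sum>i\<in>{1..r}. \<alpha> i) = n}"

definition monomial_roots ::
  "('b, 'd) ring_scheme \<Rightarrow> nat \<Rightarrow> (nat \<Rightarrow> nat \<Rightarrow> 'b) \<Rightarrow> (nat \<Rightarrow> nat) \<Rightarrow> nat \<Rightarrow> 'b"
  where "monomial_roots S r \<rho> \<alpha> e = (\<Otimes>\<^bsub>S\<^esub>i\<in>{1..r}. \<rho> i e [^]\<^bsub>S\<^esub> \<alpha> i)"

end

theory Submission
  imports Defs
begin

text \<open>A product of \<open>a\<close> roots \<open>(f\<^sup>\<alpha>)\<^bsup>1/p^e\<^esup>\<close> of monomials of degree \<open>n\<close> is the same thing as a product of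
  \<open>n a\<close> roots of the \<open>f\<^sub>i\<close>, whereas a product of \<open>b\<close> roots of the \<open>f\<^sub>i\<close> is one of \<open>n\<lfloor>b/n\<rfloor>\<close> roots times a
  remainder whose size becomes negligible against \<open>p\<^sup>e\<close> once the roots are refined. Hence
  \<open>\<tau>\<^sup>\<sharp>([f]\<^bsup>n u\<^esup>) \<subseteq> \<tau>\<^sup>\<sharp>([f\<^bsup>\<bullet>n\<^esup>]\<^sup>s) \<subseteq> \<tau>\<^sup>\<sharp>([f]\<^bsup>n s\<^esup>)\<close> for \<open>s < u\<close>, so that the two families have the
  same stable value to the right of \<open>t\<close>. Discarding the remainder requires \<open>S\<close> to act multiplicatively on local cohomology, which is the comparison
  theorem for injective resolutions.\<close>

section \<open>Linear maps and the comparison theorem\<close>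

lemma mod_homI:
  assumes "\<And>x. x \<in> carrier M \<Longrightarrow> f x \<in> carrier N"
    and "\<And>x y. x \<in> carrier M \<Longrightarrow> y \<in> carrier M \<Longrightarrow> f (x \<oplus>\<^bsub>M\<^esub> y) = f x \<oplus>\<^bsub>N\<^esub> f y"
    and "\<And>a x. a \<in> carrier R \<Longrightarrow> x \<in> carrier M \<Longrightarrow> f (a \<odot>\<^bsub>M\<^esub> x) = a \<odot>\<^bsub>N\<^esub> f x"
  shows "f \<in> mod_hom R M N"
  using assms by (auto simp: mod_hom_def)

lemma mod_homD:
  assumes "f \<in> mod_hom R M N"
  shows "x \<in> carrier M \<Longrightarrow> f x \<in> carrier N"
    and "x \<in> carrier M \<Longrightarrow> y \<in> carrier M \<Longrightarrow> f (x \<oplus>\<^bsub>M\<^esub> y) = f x \<oplus>\<^bsub>N\<^esub> f y"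
    and "a \<in> carrier R \<Longrightarrow> x \<in> carrier M \<Longrightarrow> f (a \<odot>\<^bsub>M\<^esub> x) = a \<odot>\<^bsub>N\<^esub> f x"
  using assms by (auto simp: mod_hom_def)

lemma mod_hom_zero:
  assumes "module R M" "module R N" "f \<in> mod_hom R M N"
  shows "f \<zero>\<^bsub>M\<^esub> = \<zero>\<^bsub>N\<^esub>"
proof -
  interpret M: module R M by fact
  interpret N: module R N by fact
  have "f \<zero>\<^bsub>M\<^esub> = f (\<zero>\<^bsub>R\<^esub> \<odot>\<^bsub>M\<^esub> \<zero>\<^bsub>M\<^esub>)" by simp
  also have "\<dots> = \<zero>\<^bsub>R\<^esub> \<odot>\<^bsub>N\<^esub> f \<zero>\<^bsub>M\<^esub>" by (intro mod_homD(3)[OF assms(3)]) auto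
  finally show ?thesis using mod_homD(1)[OF assms(3)] by simp
qed

lemma mod_hom_neg:
  assumes "module R M" "module R N" "f \<in> mod_hom R M N" "x \<in> carrier M"
  shows "f (\<ominus>\<^bsub>M\<^esub> x) = \<ominus>\<^bsub>N\<^esub> f x"
proof -
  interpret M: module R M by fact
  interpret N: module R N by fact
  have "f (\<ominus>\<^bsub>M\<^esub> x) \<oplus>\<^bsub>N\<^esub> f x = f (\<ominus>\<^bsub>M\<^esub> x \<oplus>\<^bsub>M\<^esub> x)"
    by (rule mod_homD(2)[OF assms(3), symmetric]) (use assms(4) in auto)
  also have "\<dots> = \<zero>\<^bsub>N\<^esub>"
    using mod_hom_zero[OF assms(1-3)] assms(4) by (simp add: M.M.l_neg)
  finally show ?thesis
    by (intro N.M.minus_equality[symmetric] mod_homD(1)[OF assms(3)]) (use assms(4) in auto)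
qed

lemma mod_hom_minus:
  assumes "module R M" "module R N" "f \<in> mod_hom R M N" "x \<in> carrier M" "y \<in> carrier M"
  shows "f (x \<ominus>\<^bsub>M\<^esub> y) = f x \<ominus>\<^bsub>N\<^esub> f y"
proof -
  interpret M: module R M by fact
  show ?thesis
    unfolding a_minus_def using assms(4,5)
    by (simp add: mod_homD(2)[OF assms(3)] mod_hom_neg[OF assms(1-3)])
qed

lemma mod_hom_comp:
  assumes "f \<in> mod_hom R L M" "g \<in> mod_hom R M N"
  shows "(\<lambda>x. g (f x)) \<in> mod_hom R L N"
  using assms by (auto simp: mod_hom_def Pi_def)

lemma mod_hom_diff:
  assumes "module R N" "f \<in> mod_hom R M N" "g \<in> mod_hom R M N"
  shows "(\<lambda>x. f x \<ominus>\<^bsub>N\<^esub> g x) \<in> mod_hom R M N"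
proof -
  interpret N: module R N by fact
  note f = mod_homD[OF assms(2)] and g = mod_homD[OF assms(3)]
  show ?thesis
  proof (rule mod_homI)
    fix x y assume "x \<in> carrier M" "y \<in> carrier M"
    then show "f (x \<oplus>\<^bsub>M\<^esub> y) \<ominus>\<^bsub>N\<^esub> g (x \<oplus>\<^bsub>M\<^esub> y) = f x \<ominus>\<^bsub>N\<^esub> g x \<oplus>\<^bsub>N\<^esub> (f y \<ominus>\<^bsub>N\<^esub> g y)"
      using f(1) g(1)
      by (simp add: f(2) g(2) a_minus_def N.M.minus_add N.M.a_ac)
  next
    fix a x assume "a \<in> carrier R" "x \<in> carrier M"
    then show "f (a \<odot>\<^bsub>M\<^esub> x) \<ominus>\<^bsub>N\<^esub> g (a \<odot>\<^bsub>M\<^esub> x) = a \<odot>\<^bsub>N\<^esub> (f x \<ominus>\<^bsub>N\<^esub> g x)"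
      using f(1) g(1)
      by (simp add: f(3) g(3) a_minus_def N.smult_r_distr N.smult_r_minus)
  qed (use f(1) g(1) in auto)
qed

lemma module_minus_eq_zero:
  assumes "module R M" "x \<in> carrier M" "y \<in> carrier M" "x \<ominus>\<^bsub>M\<^esub> y = \<zero>\<^bsub>M\<^esub>"
  shows "x = y"
proof -
  interpret module R M by fact
  have "\<ominus>\<^bsub>M\<^esub> (\<ominus>\<^bsub>M\<^esub> y) = x"
    using assms(2-) by (intro M.minus_equality) (auto simp: a_minus_def)
  then show ?thesis using assms(3) by simp
qed

lemma injective_module_is_module: "injective_module R E \<Longrightarrow> module R E"
  by (simp add: injective_module_def)

text \<open>As \<open>h\<close> vanishes on the kernel of \<open>g\<close>, it descends to the image
  of \<open>g\<close>, and injectivity of \<open>E\<close> extends the descended map to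
  \<open>Y\<close>. Since \<open>injective_module\<close> tests only modules in the type carrying
  \<open>E\<close>, \<open>Y\<close> has to live there, while \<open>L\<close> may live in another
  type, as the source of an augmentation does.\<close>

lemma injective_module_extend:
  fixes R :: "('a, 'c) ring_scheme" and L :: "('a, 'm) module" and Y E :: "('a, 'i) module"
  assumes L: "module R L" and Y: "module R Y" and E: "injective_module R E"
    and g: "g \<in> mod_hom R L Y" and h: "h \<in> mod_hom R L E"
    and ker: "\<And>x. x \<in> carrier L \<Longrightarrow> g x = \<zero>\<^bsub>Y\<^esub> \<Longrightarrow> h x = \<zero>\<^bsub>E\<^esub>"
  obtains k where "k \<in> mod_hom R Y E" "\<And>x. x \<in> carrier L \<Longrightarrow> k (g x) = h x"
proof -
  interpret L: module R L by fact
  interpret Y: module R Y by fact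
  have Em: "module R E" using E by (rule injective_module_is_module)
  note gD = mod_homD[OF g] and hD = mod_homD[OF h]
  have eq: "h x = h y" if "x \<in> carrier L" "y \<in> carrier L" "g x = g y" for x y
  proof (rule module_minus_eq_zero[OF Em])
    have "g (x \<ominus>\<^bsub>L\<^esub> y) = \<zero>\<^bsub>Y\<^esub>"
      using that gD(1) by (subst mod_hom_minus[OF L Y g]) (simp_all add: Y.M.r_neg a_minus_def)
    then have "h (x \<ominus>\<^bsub>L\<^esub> y) = \<zero>\<^bsub>E\<^esub>" using ker that by simp
    then show "h x \<ominus>\<^bsub>E\<^esub> h y = \<zero>\<^bsub>E\<^esub>" using that by (simp add: mod_hom_minus[OF L Em h])
  qed (use hD(1) that in auto)
  define U where "U = g ` carrier L"
  \<comment> \<open>The descended map: an arbitrary preimage is chosen, and \<open>eq\<close> makes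
    the choice irrelevant.\<close>
  define l where "l = (\<lambda>u. h (SOME x. x \<in> carrier L \<and> g x = u))"
  have l: "l (g x) = h x" if "x \<in> carrier L" for x
  proof -
    have "\<exists>z. z \<in> carrier L \<and> g z = g x" using that by blast
    from someI_ex[OF this] show ?thesis
      unfolding l_def using eq that by blast
  qed
  have U: "submodule U R Y"
  proof (rule Y.submoduleI)
    show "U \<subseteq> carrier Y" unfolding U_def using gD(1) by auto
    show "\<zero>\<^bsub>Y\<^esub> \<in> U" unfolding U_def
      using mod_hom_zero[OF L Y g] L.M.zero_closed by (metis imageI)
    show "\<ominus>\<^bsub>Y\<^esub> a \<in> U" if "a \<in> U" for a
      using that unfolding U_def
      by (auto simp: mod_hom_neg[OF L Y g, symmetric])
    show "a \<oplus>\<^bsub>Y\<^esub> b \<in> U" if "a \<in> U" "b \<in> U" for a b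
      using that unfolding U_def by (auto simp: gD(2)[symmetric])
    show "a \<odot>\<^bsub>Y\<^esub> b \<in> U" if "a \<in> carrier R" "b \<in> U" for a b
      using that unfolding U_def by (auto simp: gD(3)[symmetric])
  qed
  have "l \<in> mod_hom R (Y\<lparr>carrier := U\<rparr>) E"
  proof (rule mod_homI)
    show "l x \<in> carrier E" if "x \<in> carrier (Y\<lparr>carrier := U\<rparr>)" for x
      using that l hD(1) by (auto simp: U_def)
    show "l (x \<oplus>\<^bsub>Y\<lparr>carrier := U\<rparr>\<^esub> y) = l x \<oplus>\<^bsub>E\<^esub> l y"
      if "x \<in> carrier (Y\<lparr>carrier := U\<rparr>)" "y \<in> carrier (Y\<lparr>carrier := U\<rparr>)" for x y
      using that by (auto simp: U_def gD(2)[symmetric] l hD(2))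
    show "l (a \<odot>\<^bsub>Y\<lparr>carrier := U\<rparr>\<^esub> x) = a \<odot>\<^bsub>E\<^esub> l x"
      if "a \<in> carrier R" "x \<in> carrier (Y\<lparr>carrier := U\<rparr>)" for a x
      using that by (auto simp: U_def gD(3)[symmetric] l hD(3))
  qed
  with E Y U obtain k where "k \<in> mod_hom R Y E" "\<forall>x\<in>U. k x = l x"
    unfolding injective_module_def by blast
  with l show thesis by (intro that[of k]) (auto simp: U_def)
qed

section \<open>Injective resolutions: lifting maps and comparing lifts\<close>

lemma injective_resolutionD:
  assumes "injective_resolution A M I"
  shows "injective_module A (term_at I n)" "module A (term_at I n)"
    "diff_at I n \<in> mod_hom A (term_at I n) (term_at I (Suc n))"
    "aug I \<in> mod_hom A M (term_at I 0)" "inj_on (aug I) (carrier M)"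
    "x \<in> carrier M \<Longrightarrow> diff_at I 0 (aug I x) = \<zero>\<^bsub>term_at I 1\<^esub>"
    "y \<in> carrier (term_at I 0) \<Longrightarrow> diff_at I 0 y = \<zero>\<^bsub>term_at I 1\<^esub> \<Longrightarrow> y \<in> aug I ` carrier M"
    "z \<in> carrier (term_at I n) \<Longrightarrow> diff_at I (Suc n) (diff_at I n z) = \<zero>\<^bsub>term_at I (Suc (Suc n))\<^esub>"
    "w \<in> carrier (term_at I (Suc n)) \<Longrightarrow> diff_at I (Suc n) w = \<zero>\<^bsub>term_at I (Suc (Suc n))\<^esub>
      \<Longrightarrow> w \<in> diff_at I n ` carrier (term_at I n)"
proof -
  note r = assms[unfolded injective_resolution_def]
  show "injective_module A (term_at I n)" "module A (term_at I n)"
    "diff_at I n \<in> mod_hom A (term_at I n) (term_at I (Suc n))"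
    "aug I \<in> mod_hom A M (term_at I 0)" "inj_on (aug I) (carrier M)"
    using r injective_module_is_module by blast+
  show "x \<in> carrier M \<Longrightarrow> diff_at I 0 (aug I x) = \<zero>\<^bsub>term_at I 1\<^esub>"
    "y \<in> carrier (term_at I 0) \<Longrightarrow> diff_at I 0 y = \<zero>\<^bsub>term_at I 1\<^esub> \<Longrightarrow> y \<in> aug I ` carrier M"
    "z \<in> carrier (term_at I n) \<Longrightarrow> diff_at I (Suc n) (diff_at I n z) = \<zero>\<^bsub>term_at I (Suc (Suc n))\<^esub>"
    "w \<in> carrier (term_at I (Suc n)) \<Longrightarrow> diff_at I (Suc n) w = \<zero>\<^bsub>term_at I (Suc (Suc n))\<^esub>
      \<Longrightarrow> w \<in> diff_at I n ` carrier (term_at I n)"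
    using r by blast+
qed

lemma chain_liftD:
  assumes "chain_lift A M I J f F"
  shows "F n \<in> mod_hom A (term_at I n) (term_at J n)"
    "x \<in> carrier (term_at I n) \<Longrightarrow> F (Suc n) (diff_at I n x) = diff_at J n (F n x)"
    "y \<in> carrier M \<Longrightarrow> F 0 (aug I y) = aug J (f y)"
  using assms unfolding chain_lift_def by auto

text \<open>Existence half of the comparison theorem. Each component comes from extending
  \<open>diff_at J n\<close> after \<open>F n\<close> along \<open>diff_at I n\<close>, which
  injectivity of the next term of \<open>J\<close> permits.\<close>

lemma chain_lift_exists:
  fixes A :: "('a, 'c) ring_scheme" and M :: "('a, 'm) module" and N :: "('a, 'n) module"
    and I :: "('a, 'm, 'i) coresolution" and J :: "('a, 'n, 'i) coresolution"
  assumes M: "module A M" and N: "module A N" and f: "f \<in> mod_hom A M N"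
    and I: "injective_resolution A M I" and J: "injective_resolution A N J"
  shows "\<exists>F. chain_lift A M I J f F"
proof -
  note ID = injective_resolutionD[OF I] and JD = injective_resolutionD[OF J]
  note fD = mod_homD[OF f]
  \<comment> \<open>The kernel clause is exactly the hypothesis of the next extension, so it has to
    travel through the recursion. The last clause pins down the bottom component only.\<close>
  define P where "P = (\<lambda>n F. F \<in> mod_hom A (term_at I n) (term_at J n) \<and>
    (\<forall>x\<in>carrier (term_at I n). diff_at I n x = \<zero>\<^bsub>term_at I (Suc n)\<^esub> \<longrightarrow>
       diff_at J n (F x) = \<zero>\<^bsub>term_at J (Suc n)\<^esub>) \<and>
    (n = 0 \<longrightarrow> (\<forall>x\<in>carrier M. F (aug I x) = aug J (f x))))"
  define Q where "Q = (\<lambda>n F G. \<forall>x\<in>carrier (term_at I n). G (diff_at I n x) = diff_at J n (F x))"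
  have "\<exists>F. \<forall>n. P n (F n) \<and> Q n (F n) (F (Suc n))"
  proof (rule dependent_nat_choice)
    obtain F where F: "F \<in> mod_hom A (term_at I 0) (term_at J 0)"
      "\<And>x. x \<in> carrier M \<Longrightarrow> F (aug I x) = aug J (f x)"
    proof (rule injective_module_extend[OF M ID(2) JD(1) ID(4) mod_hom_comp[OF f JD(4)]])
      \<comment> \<open>Injectivity of the augmentation leaves only x = 0 in the kernel.\<close>
      fix x assume x: "x \<in> carrier M" "aug I x = \<zero>\<^bsub>term_at I 0\<^esub>"
      then have "aug I x = aug I \<zero>\<^bsub>M\<^esub>" using mod_hom_zero[OF M ID(2) ID(4)] by simp
      then have "x = \<zero>\<^bsub>M\<^esub>"
        using ID(5) x(1) M by (auto dest: inj_onD simp: module_def abelian_group_def abelian_monoid.zero_closed)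
      then show "aug J (f x) = \<zero>\<^bsub>term_at J 0\<^esub>"
        using mod_hom_zero[OF M N f] mod_hom_zero[OF N JD(2) JD(4)] by simp
    qed blast
    \<comment> \<open>By exactness a kernel element of \<open>diff_at I 0\<close> is an augmented
      element of \<open>M\<close>; \<open>F\<close> sends it to an augmented element of
      \<open>N\<close>, which \<open>diff_at J 0\<close> kills.\<close>
    then have "P 0 F" using ID(7) JD(6) fD(1) unfolding P_def by force
    then show "\<exists>F. P 0 F" by blast
  next
    fix F n assume P: "P n F"
    then have F: "F \<in> mod_hom A (term_at I n) (term_at J n)" by (simp add: P_def)
    obtain G where G: "G \<in> mod_hom A (term_at I (Suc n)) (term_at J (Suc n))"
      "\<And>x. x \<in> carrier (term_at I n) \<Longrightarrow> G (diff_at I n x) = diff_at J n (F x)"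
      by (rule injective_module_extend[OF ID(2) ID(2) JD(1) ID(3) mod_hom_comp[OF F JD(3)]])
        (use P in \<open>auto simp: P_def\<close>)
    have "P (Suc n) G" unfolding P_def
    proof (intro conjI ballI impI)
      fix x assume "x \<in> carrier (term_at I (Suc n))"
        "diff_at I (Suc n) x = \<zero>\<^bsub>term_at I (Suc (Suc n))\<^esub>"
      then obtain y where "y \<in> carrier (term_at I n)" "x = diff_at I n y" using ID(9) by blast
      then show "diff_at J (Suc n) (G x) = \<zero>\<^bsub>term_at J (Suc (Suc n))\<^esub>"
        using G(2) JD(8) mod_homD(1)[OF F] by simp
    qed (use G in auto)
    moreover have "Q n F G" using G(2) by (simp add: Q_def)
    ultimately show "\<exists>G. P (Suc n) G \<and> Q n F G" by blast
  qed
  then show ?thesis unfolding P_def Q_def chain_lift_def by blast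
qed

text \<open>Uniqueness half of the comparison theorem: a chain map that kills the augmentation is
  null-homotopic. Degree 0 has its own equation because no term of the resolution precedes
  it.\<close>

lemma null_homotopy:
  fixes A :: "('a, 'c) ring_scheme" and M :: "('a, 'm) module" and N :: "('a, 'n) module"
    and I :: "('a, 'm, 'i) coresolution" and J :: "('a, 'n, 'i) coresolution"
  assumes I: "injective_resolution A M I" and J: "injective_resolution A N J"
    and D: "\<And>n. D n \<in> mod_hom A (term_at I n) (term_at J n)"
    and comm: "\<And>n x. x \<in> carrier (term_at I n) \<Longrightarrow> D (Suc n) (diff_at I n x) = diff_at J n (D n x)"
    and aug: "\<And>x. x \<in> carrier M \<Longrightarrow> D 0 (aug I x) = \<zero>\<^bsub>term_at J 0\<^esub>"
  obtains s where "\<And>n. s n \<in> mod_hom A (term_at I (Suc n)) (term_at J n)"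
    "\<And>x. x \<in> carrier (term_at I 0) \<Longrightarrow> s 0 (diff_at I 0 x) = D 0 x"
    "\<And>n x. x \<in> carrier (term_at I (Suc n)) \<Longrightarrow>
       s (Suc n) (diff_at I (Suc n) x) = D (Suc n) x \<ominus>\<^bsub>term_at J (Suc n)\<^esub> diff_at J n (s n x)"
proof -
  note ID = injective_resolutionD[OF I] and JD = injective_resolutionD[OF J]
  \<comment> \<open>The middle clause makes \<open>D (Suc n)\<close> minus
    \<open>diff_at J n\<close> after \<open>s\<close> vanish on the image of
    \<open>diff_at I n\<close>, which by exactness is the kernel along which the next homotopy
    component is extended.\<close>
  define P where "P = (\<lambda>n s. s \<in> mod_hom A (term_at I (Suc n)) (term_at J n) \<and>
    (\<forall>x\<in>carrier (term_at I n). diff_at J n (s (diff_at I n x)) = diff_at J n (D n x)) \<and>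
    (n = 0 \<longrightarrow> (\<forall>x\<in>carrier (term_at I 0). s (diff_at I 0 x) = D 0 x)))"
  define Q where "Q = (\<lambda>n s s'. \<forall>x\<in>carrier (term_at I (Suc n)).
    s' (diff_at I (Suc n) x) = D (Suc n) x \<ominus>\<^bsub>term_at J (Suc n)\<^esub> diff_at J n (s x))"
  have "\<exists>s. \<forall>n. P n (s n) \<and> Q n (s n) (s (Suc n))"
  proof (rule dependent_nat_choice)
    obtain s where s: "s \<in> mod_hom A (term_at I (Suc 0)) (term_at J 0)"
      "\<And>x. x \<in> carrier (term_at I 0) \<Longrightarrow> s (diff_at I 0 x) = D 0 x"
      by (rule injective_module_extend[OF ID(2) ID(2) JD(1) ID(3) D])
        (use ID(7) aug in auto)
    then have "P 0 s" unfolding P_def by auto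
    then show "\<exists>s. P 0 s" by blast
  next
    fix s n assume P: "P n s"
    then have s: "s \<in> mod_hom A (term_at I (Suc n)) (term_at J n)" by (simp add: P_def)
    let ?J = "term_at J (Suc n)"
    let ?h = "\<lambda>x. D (Suc n) x \<ominus>\<^bsub>?J\<^esub> diff_at J n (s x)"
    have h: "?h \<in> mod_hom A (term_at I (Suc n)) ?J"
      by (rule mod_hom_diff[OF JD(2) D mod_hom_comp[OF s JD(3)]])
    obtain k where k: "k \<in> mod_hom A (term_at I (Suc (Suc n))) ?J"
      "\<And>x. x \<in> carrier (term_at I (Suc n)) \<Longrightarrow> k (diff_at I (Suc n) x) = ?h x"
    proof (rule injective_module_extend[OF ID(2) ID(2) JD(1) ID(3) h])
      fix x assume "x \<in> carrier (term_at I (Suc n))"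
        "diff_at I (Suc n) x = \<zero>\<^bsub>term_at I (Suc (Suc n))\<^esub>"
      then obtain y where y: "y \<in> carrier (term_at I n)" "x = diff_at I n y" using ID(9) by blast
      interpret J: module A ?J by (rule JD(2))
      have "diff_at J n (D n y) \<in> carrier ?J" using y D JD(3) by (meson mod_homD(1))
      then show "?h x = \<zero>\<^bsub>?J\<^esub>"
        using y P by (simp add: P_def comm J.M.r_neg a_minus_def)
    qed blast
    \<comment> \<open>Applying \<open>diff_at J (Suc n)\<close> to the defining equation of
      \<open>k\<close> removes the homotopy term, since two consecutive differentials compose to
      zero.\<close>
    have "P (Suc n) k" unfolding P_def
    proof (intro conjI ballI impI)
      fix x assume x: "x \<in> carrier (term_at I (Suc n))"
      interpret J: module A "term_at J (Suc (Suc n))" by (rule JD(2))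
      have c: "D (Suc n) x \<in> carrier ?J" "diff_at J n (s x) \<in> carrier ?J"
        "diff_at J (Suc n) (D (Suc n) x) \<in> carrier (term_at J (Suc (Suc n)))"
        using x D JD(3) s by (meson mod_homD(1))+
      have "diff_at J (Suc n) (diff_at J n (s x)) = \<zero>\<^bsub>term_at J (Suc (Suc n))\<^esub>"
        using JD(8) mod_homD(1)[OF s x] by blast
      then show "diff_at J (Suc n) (k (diff_at I (Suc n) x)) = diff_at J (Suc n) (D (Suc n) x)"
        using x c by (simp add: k(2) mod_hom_minus[OF JD(2) JD(2) JD(3)]) (simp add: a_minus_def)
    qed (use k in auto)
    moreover have "Q n s k" using k(2) by (simp add: Q_def)
    ultimately show "\<exists>k. P (Suc n) k \<and> Q n s k" by blast
  qed
  then obtain s where "\<forall>n. P n (s n) \<and> Q n (s n) (s (Suc n))" by blast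
  then show thesis by (intro that[of s]) (auto simp: P_def Q_def)
qed

section \<open>The module structure of local cohomology\<close>

lemma ideal_pow_ideal: "cring R \<Longrightarrow> ideal m R \<Longrightarrow> ideal (ideal_pow R m k) R"
proof (induction k)
  case 0
  then interpret cring R by simp
  show ?case by (simp add: oneideal)
next
  case (Suc k)
  then interpret cring R by simp
  show ?case using Suc by (simp add: ideal_prod_is_ideal)
qed

lemma ideal_pow_antimono:
  assumes "cring R" "ideal m R" "k \<le> l"
  shows "ideal_pow R m l \<subseteq> ideal_pow R m k"
  using assms(3)
proof (induction l rule: dec_induct)
  case (step l)
  interpret cring R by fact
  have "ideal_pow R m (Suc l) \<subseteq> ideal_pow R m l"
    using ideal_prod_inter[OF ideal_pow_ideal[OF assms(1,2)] assms(2)] by auto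
  with step show ?case by blast
qed simp

section \<open>Torsion submodules, cycles and boundaries\<close>

lemma torsion_mod_hom:
  assumes "module A E" "module A E'" "f \<in> mod_hom A E E'" "cring A" "ideal m A" "x \<in> torsion A m E"
  shows "f x \<in> torsion A m E'"
proof -
  obtain k where k: "x \<in> carrier E" "\<forall>a\<in>ideal_pow A m k. a \<odot>\<^bsub>E\<^esub> x = \<zero>\<^bsub>E\<^esub>"
    using assms(6) by (auto simp: torsion_def)
  have "a \<odot>\<^bsub>E'\<^esub> f x = \<zero>\<^bsub>E'\<^esub>" if "a \<in> ideal_pow A m k" for a
  proof -
    have "a \<in> carrier A"
      using ideal.Icarr[OF ideal_pow_ideal[OF assms(4,5)] that] .
    then show ?thesis
      using k that mod_homD(3)[OF assms(3)] mod_hom_zero[OF assms(1-3)] by metis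
  qed
  then show ?thesis using k(1) mod_homD(1)[OF assms(3)] by (auto simp: torsion_def)
qed

lemma torsion_additive_subgroup:
  assumes "module A E" "ideal m A"
  shows "additive_subgroup (torsion A m E) E"
proof -
  interpret module A E by fact
  have A: "cring A" ..
  note Icarr = ideal.Icarr[OF ideal_pow_ideal[OF A assms(2)]]
  have "subgroup (torsion A m E) (add_monoid E)"
  proof (rule M.add.subgroupI)
    show "torsion A m E \<subseteq> carrier E" by (auto simp: torsion_def)
    have "\<zero>\<^bsub>E\<^esub> \<in> torsion A m E" using Icarr by (auto simp: torsion_def)
    then show "torsion A m E \<noteq> {}" by blast
    show "\<ominus>\<^bsub>E\<^esub> x \<in> torsion A m E" if x: "x \<in> torsion A m E" for x
    proof -
      obtain k where "x \<in> carrier E" "\<forall>a\<in>ideal_pow A m k. a \<odot>\<^bsub>E\<^esub> x = \<zero>\<^bsub>E\<^esub>"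
        using x by (auto simp: torsion_def)
      then show ?thesis using Icarr
        by (auto simp: torsion_def smult_r_minus intro!: exI[of _ k])
    qed
    show "x \<oplus>\<^bsub>E\<^esub> y \<in> torsion A m E" if xy: "x \<in> torsion A m E" "y \<in> torsion A m E" for x y
    proof -
      obtain k l where kl: "x \<in> carrier E" "\<forall>a\<in>ideal_pow A m k. a \<odot>\<^bsub>E\<^esub> x = \<zero>\<^bsub>E\<^esub>"
        "y \<in> carrier E" "\<forall>a\<in>ideal_pow A m l. a \<odot>\<^bsub>E\<^esub> y = \<zero>\<^bsub>E\<^esub>"
        using xy by (auto simp: torsion_def)
      \<comment> \<open>Powers of \<open>m\<close> decrease, so the larger of the two exponents
        kills both summands.\<close>
      have "ideal_pow A m (max k l) \<subseteq> ideal_pow A m k" "ideal_pow A m (max k l) \<subseteq> ideal_pow A m l"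
        by (simp_all add: ideal_pow_antimono[OF A assms(2)])
      then have "\<forall>a\<in>ideal_pow A m (max k l). a \<odot>\<^bsub>E\<^esub> (x \<oplus>\<^bsub>E\<^esub> y) = \<zero>\<^bsub>E\<^esub>"
        using kl Icarr by (auto simp: smult_r_distr subset_iff)
      then show ?thesis using kl by (auto simp: torsion_def)
    qed
  qed
  then show ?thesis by (simp add: additive_subgroup_def)
qed

lemma additive_subgroup_image:
  assumes "module A E" "module A E'" "f \<in> mod_hom A E E'" "additive_subgroup T E"
  shows "additive_subgroup (f ` T) E'"
proof -
  interpret E: module A E by fact
  interpret E': module A E' by fact
  interpret T: additive_subgroup T E by fact
  note f = mod_homD[OF assms(3)]
  have "subgroup (f ` T) (add_monoid E')"
  proof (rule E'.M.add.subgroupI)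
    show "f ` T \<subseteq> carrier E'" using f(1) T.a_subset by auto
    show "f ` T \<noteq> {}" using T.zero_closed by blast
    show "\<ominus>\<^bsub>E'\<^esub> y \<in> f ` T" if y: "y \<in> f ` T" for y
    proof -
      obtain x where x: "x \<in> T" "y = f x" using y by blast
      then have "\<ominus>\<^bsub>E'\<^esub> y = f (\<ominus>\<^bsub>E\<^esub> x)" using T.a_subset mod_hom_neg[OF assms(1-3)] by auto
      then show ?thesis using T.a_inv_closed[OF x(1)] by blast
    qed
    show "y \<oplus>\<^bsub>E'\<^esub> z \<in> f ` T" if yz: "y \<in> f ` T" "z \<in> f ` T" for y z
    proof -
      obtain u v where uv: "u \<in> T" "y = f u" "v \<in> T" "z = f v" using yz by blast
      then have "y \<oplus>\<^bsub>E'\<^esub> z = f (u \<oplus>\<^bsub>E\<^esub> v)" using T.a_subset f(2) by auto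
      then show ?thesis using T.a_closed uv by blast
    qed
  qed
  then show ?thesis by (simp add: additive_subgroup_def)
qed

lemma lc_boundaries_additive_subgroup:
  assumes "injective_resolution A M I" "ideal m A"
  shows "additive_subgroup (lc_boundaries A m I i) (term_at I i)"
proof (cases i)
  case 0
  interpret module A "term_at I 0" by (rule injective_resolutionD(2)[OF assms(1)])
  have "subgroup {\<zero>\<^bsub>term_at I 0\<^esub>} (add_monoid (term_at I 0))"
    by (rule M.add.subgroupI) auto
  then show ?thesis by (simp add: 0 lc_boundaries_def additive_subgroup_def)
next
  case (Suc j)
  note ID = injective_resolutionD[OF assms(1)]
  show ?thesis
    using additive_subgroup_image[OF ID(2) ID(2) ID(3) torsion_additive_subgroup[OF ID(2) assms(2)]]
    by (simp add: Suc lc_boundaries_def)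
qed

lemma lc_cycles_carrier: "z \<in> lc_cycles A m I i \<Longrightarrow> z \<in> carrier (term_at I i)"
  by (simp add: lc_cycles_def torsion_def)

lemma coset_eqI:
  assumes "additive_subgroup B G" "abelian_group G" "y \<in> carrier G" "b \<in> B" "z = b \<oplus>\<^bsub>G\<^esub> y"
  shows "B +>\<^bsub>G\<^esub> z = B +>\<^bsub>G\<^esub> y"
proof -
  interpret abelian_subgroup B G by (rule abelian_subgroupI3) fact+
  have "z \<in> B +>\<^bsub>G\<^esub> y" using assms(4,5) by (auto simp: a_r_coset_def')
  then show ?thesis using a_repr_independence[OF _ assms(3)] a_subgroup by metis
qed

lemma local_cohomology_simps:
  "carrier (local_cohomology A m I i) =
     (\<lambda>z. lc_boundaries A m I i +>\<^bsub>term_at I i\<^esub> z) ` lc_cycles A m I i"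
  "\<zero>\<^bsub>local_cohomology A m I i\<^esub> = lc_boundaries A m I i"
  by (auto simp: local_cohomology_def subquotient_def quot_module_def A_RCOSETS_def' a_r_coset_def')

text \<open>Two lifts of one map differ by a null-homotopic chain map; a homotopy is linear over \<open>A\<close>,
  so it respects torsion.\<close>

lemma chain_lift_unique_on_cycles:
  fixes I :: "('a, 'm, 'i) coresolution" and J :: "('a, 'n, 'i) coresolution"
  assumes m: "ideal m A" and I: "injective_resolution A M I" and J: "injective_resolution A N J"
    and F: "chain_lift A M I J f F" and G: "chain_lift A M I J f G"
    and f: "f \<in> mod_hom A M N" and z: "z \<in> lc_cycles A m I i"
  shows "F i z \<ominus>\<^bsub>term_at J i\<^esub> G i z \<in> lc_boundaries A m J i"
proof -
  note ID = injective_resolutionD[OF I] and JD = injective_resolutionD[OF J]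
  note FD = chain_liftD[OF F] and GD = chain_liftD[OF G]
  interpret A: module A "term_at J 0" by (rule JD(2))
  have A: "cring A" ..
  \<comment> \<open>Both lifts cover the same \<open>f\<close>, so their difference is a chain map
    that kills the augmentation and has a null-homotopy.\<close>
  define D where "D = (\<lambda>n x. F n x \<ominus>\<^bsub>term_at J n\<^esub> G n x)"
  have Dh: "D n \<in> mod_hom A (term_at I n) (term_at J n)" for n
    unfolding D_def by (rule mod_hom_diff[OF JD(2) FD(1) GD(1)])
  have comm: "D (Suc n) (diff_at I n x) = diff_at J n (D n x)" if "x \<in> carrier (term_at I n)" for n x
    using that by (simp add: D_def FD(2) GD(2) mod_hom_minus[OF JD(2) JD(2) JD(3)]
        mod_homD(1)[OF FD(1)] mod_homD(1)[OF GD(1)])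
  have aug: "D 0 (aug I x) = \<zero>\<^bsub>term_at J 0\<^esub>" if "x \<in> carrier M" for x
    using that mod_homD(1)[OF JD(4)] mod_homD(1)[OF f]
    by (simp add: D_def FD(3) GD(3) a_minus_def A.M.r_neg)
  obtain s where s: "\<And>n. s n \<in> mod_hom A (term_at I (Suc n)) (term_at J n)"
    "\<And>x. x \<in> carrier (term_at I 0) \<Longrightarrow> s 0 (diff_at I 0 x) = D 0 x"
    "\<And>n x. x \<in> carrier (term_at I (Suc n)) \<Longrightarrow>
       s (Suc n) (diff_at I (Suc n) x) = D (Suc n) x \<ominus>\<^bsub>term_at J (Suc n)\<^esub> diff_at J n (s n x)"
    using null_homotopy[where D = D, OF I J Dh comm aug] by blast
  have zc: "z \<in> torsion A m (term_at I i)" "z \<in> carrier (term_at I i)"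
    "diff_at I i z = \<zero>\<^bsub>term_at I (Suc i)\<^esub>"
    using z by (auto simp: lc_cycles_def torsion_def)
  have "D i z \<in> lc_boundaries A m J i"
  proof (cases i)
    case 0
    \<comment> \<open>In degree 0 the homotopy has a single term, which vanishes on cycles; this
      matches the convention that only zero is a boundary there.\<close>
    then have "D 0 z = s 0 \<zero>\<^bsub>term_at I (Suc 0)\<^esub>" using s(2) zc by metis
    then show ?thesis using mod_hom_zero[OF ID(2) JD(2) s(1)] by (simp add: 0 lc_boundaries_def)
  next
    case (Suc j)
    \<comment> \<open>On a cycle the homotopy formula leaves only the differential of
      \<open>s j z\<close>. It is a boundary of the torsion complex because \<open>s j z\<close> is
      again torsion.\<close>
    have t: "s j z \<in> torsion A m (term_at J j)"
      using torsion_mod_hom[OF ID(2) JD(2) s(1) A m] zc(1) Suc by metis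
    have "D (Suc j) z \<ominus>\<^bsub>term_at J (Suc j)\<^esub> diff_at J j (s j z) = \<zero>\<^bsub>term_at J (Suc j)\<^esub>"
      using s(3)[of z j] zc Suc mod_hom_zero[OF ID(2) JD(2) s(1)] by simp
    then have "D (Suc j) z = diff_at J j (s j z)"
    proof (rule module_minus_eq_zero[OF JD(2), rotated 2])
      show "D (Suc j) z \<in> carrier (term_at J (Suc j))" using mod_homD(1)[OF Dh] zc(2) Suc by blast
      show "diff_at J j (s j z) \<in> carrier (term_at J (Suc j))"
        using mod_homD(1)[OF JD(3)] mod_homD(1)[OF s(1)] zc(2) Suc by blast
    qed
    then show ?thesis using t by (simp add: Suc lc_boundaries_def)
  qed
  then show ?thesis by (simp add: D_def)
qed

lemma chain_lift_cycles:
  assumes "ideal m A" "injective_resolution A M I" "injective_resolution A N J"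
    "chain_lift A M I J f F" "z \<in> lc_cycles A m I i"
  shows "F i z \<in> lc_cycles A m J i"
proof -
  note ID = injective_resolutionD[OF assms(2)] and JD = injective_resolutionD[OF assms(3)]
  note FD = chain_liftD[OF assms(4)]
  interpret A: module A "term_at J 0" by (rule JD(2))
  have A: "cring A" ..
  have zc: "z \<in> torsion A m (term_at I i)" "z \<in> carrier (term_at I i)"
    "diff_at I i z = \<zero>\<^bsub>term_at I (Suc i)\<^esub>"
    using assms(5) by (auto simp: lc_cycles_def torsion_def)
  have "diff_at J i (F i z) = F (Suc i) \<zero>\<^bsub>term_at I (Suc i)\<^esub>"
    using FD(2)[OF zc(2)] zc(3) by simp
  then show ?thesis
    using torsion_mod_hom[OF ID(2) JD(2) FD(1) A assms(1) zc(1)] mod_hom_zero[OF ID(2) JD(2) FD(1)]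
    by (simp add: lc_cycles_def)
qed

lemma chain_lift_boundaries:
  assumes "ideal m A" "injective_resolution A M I" "injective_resolution A N J"
    "chain_lift A M I J f F" "b \<in> lc_boundaries A m I i"
  shows "F i b \<in> lc_boundaries A m J i"
proof -
  note ID = injective_resolutionD[OF assms(2)] and JD = injective_resolutionD[OF assms(3)]
  note FD = chain_liftD[OF assms(4)]
  interpret A: module A "term_at J 0" by (rule JD(2))
  have A: "cring A" ..
  show ?thesis
  proof (cases i)
    case 0
    then show ?thesis using assms(5) mod_hom_zero[OF ID(2) JD(2) FD(1)]
      by (simp add: lc_boundaries_def)
  next
    case (Suc j)
    then obtain u where u: "u \<in> torsion A m (term_at I j)" "b = diff_at I j u"
      using assms(5) by (auto simp: lc_boundaries_def)
    then have "F i b = diff_at J j (F j u)" using FD(2) Suc by (auto simp: torsion_def)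
    then show ?thesis
      using torsion_mod_hom[OF ID(2) JD(2) FD(1) A assms(1) u(1)] by (simp add: Suc lc_boundaries_def)
  qed
qed

text \<open>Frees \<open>lc_map\<close> from its two choices. Changing the representative of the
  class alters the value by a boundary, and so does replacing the lift picked by \<open>SOME\<close>
  with \<open>F\<close>; hence all cosets in the defining union coincide.\<close>

lemma lc_map_coset:
  fixes I :: "('a, 'm, 'i) coresolution" and J :: "('a, 'n, 'i) coresolution"
  assumes m: "ideal m A" and I: "injective_resolution A M I" and J: "injective_resolution A N J"
    and f: "f \<in> mod_hom A M N" and F: "chain_lift A M I J f F" and z: "z \<in> lc_cycles A m I i"
  shows "lc_map A m M I J i f (lc_boundaries A m I i +>\<^bsub>term_at I i\<^esub> z) =
    lc_boundaries A m J i +>\<^bsub>term_at J i\<^esub> F i z"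
proof -
  note ID = injective_resolutionD[OF I] and JD = injective_resolutionD[OF J]
  interpret Ii: module A "term_at I i" by (rule ID(2))
  interpret Ji: module A "term_at J i" by (rule JD(2))
  define G where "G = (SOME F. chain_lift A M I J f F)"
  have G: "chain_lift A M I J f G" unfolding G_def using someI[of "chain_lift A M I J f", OF F] .
  let ?B = "lc_boundaries A m I i" and ?C = "lc_boundaries A m J i"
  interpret B: additive_subgroup ?B "term_at I i" by (rule lc_boundaries_additive_subgroup[OF I m])
  interpret C: additive_subgroup ?C "term_at J i" by (rule lc_boundaries_additive_subgroup[OF J m])
  note coset = coset_eqI[OF C.additive_subgroup_axioms Ji.abelian_group_axioms]
  have zc: "z \<in> carrier (term_at I i)" by (rule lc_cycles_carrier[OF z])
  have Fz: "F i z \<in> carrier (term_at J i)" and Gz: "G i z \<in> carrier (term_at J i)"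
    using zc mod_homD(1)[OF chain_liftD(1)] F G by metis+
  have "?C +>\<^bsub>term_at J i\<^esub> G i w = ?C +>\<^bsub>term_at J i\<^esub> F i z" if w: "w \<in> ?B +>\<^bsub>term_at I i\<^esub> z" for w
  proof -
    obtain b where b: "b \<in> ?B" "w = b \<oplus>\<^bsub>term_at I i\<^esub> z"
      using w by (auto simp: a_r_coset_def')
    have "G i w = G i b \<oplus>\<^bsub>term_at J i\<^esub> G i z"
      using mod_homD(2)[OF chain_liftD(1)[OF G]] b B.a_subset zc by auto
    then have "?C +>\<^bsub>term_at J i\<^esub> G i w = ?C +>\<^bsub>term_at J i\<^esub> G i z"
      using coset Gz chain_lift_boundaries[OF m I J G b(1)] by blast
    also have "\<dots> = ?C +>\<^bsub>term_at J i\<^esub> F i z"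
    proof (rule coset[OF Fz chain_lift_unique_on_cycles[OF m I J G F f z]])
      show "G i z = G i z \<ominus>\<^bsub>term_at J i\<^esub> F i z \<oplus>\<^bsub>term_at J i\<^esub> F i z"
        using Fz Gz by (simp add: a_minus_def Ji.M.a_assoc Ji.M.l_neg)
    qed
    finally show ?thesis .
  qed
  \<comment> \<open>The union must be over a nonempty set to equal the common coset.\<close>
  moreover have "z \<in> ?B +>\<^bsub>term_at I i\<^esub> z"
    using B.zero_closed zc by (auto simp: a_r_coset_def' intro!: bexI[of _ "\<zero>\<^bsub>term_at I i\<^esub>"])
  ultimately show ?thesis unfolding lc_map_def G_def[symmetric] by blast
qed

text \<open>\<open>h\<close> is compared with the composite only on the carrier, because
  associativity in \<open>S\<close>, the intended application, holds only there.\<close>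

lemma chain_lift_comp:
  assumes "chain_lift A M I J f F" "chain_lift A N J K g G" "f \<in> carrier M \<rightarrow> carrier N"
    and "\<And>x. x \<in> carrier M \<Longrightarrow> h x = g (f x)"
  shows "chain_lift A M I K h (\<lambda>n x. G n (F n x))"
  using assms(3,4) mod_hom_comp[OF chain_liftD(1)[OF assms(1)] chain_liftD(1)[OF assms(2)]]
    chain_liftD(2,3)[OF assms(1)] chain_liftD(2,3)[OF assms(2)]
    mod_homD(1)[OF chain_liftD(1)[OF assms(1)]]
  unfolding chain_lift_def by (auto simp: Pi_def)

section \<open>The action of S on local cohomology\<close>

lemma restrict_scalars_module:
  assumes "cring A" "cring S" "\<phi> \<in> ring_hom A S"
  shows "module A (restrict_scalars S \<phi>)"
proof -
  interpret A: cring A by fact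
  interpret S: cring S by fact
  interpret h: ring_hom_ring A S \<phi>
    by (intro ring_hom_ringI2 assms A.ring_axioms S.ring_axioms)
  show ?thesis
  proof (rule moduleI)
    show "abelian_group (restrict_scalars S \<phi>)"
    proof (rule abelian_groupI)
      show "\<exists>y\<in>carrier (restrict_scalars S \<phi>).
          y \<oplus>\<^bsub>restrict_scalars S \<phi>\<^esub> x = \<zero>\<^bsub>restrict_scalars S \<phi>\<^esub>"
        if "x \<in> carrier (restrict_scalars S \<phi>)" for x
        using that S.l_neg[of x] by (auto simp: restrict_scalars_def intro!: bexI[of _ "\<ominus>\<^bsub>S\<^esub> x"])
    qed (auto simp: restrict_scalars_def S.a_ac)
  qed (auto simp: restrict_scalars_def S.l_distr S.r_distr S.m_assoc assms)
qed

lemma mult_mod_hom: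
  assumes "cring S" "\<phi> \<in> ring_hom A S" "s \<in> carrier S"
  shows "(\<lambda>x. s \<otimes>\<^bsub>S\<^esub> x) \<in> mod_hom A (restrict_scalars S \<phi>) (restrict_scalars S \<phi>)"
proof -
  interpret S: cring S by fact
  show ?thesis
    by (rule mod_homI)
      (use assms(3) ring_hom_closed[OF assms(2)] in \<open>auto simp: restrict_scalars_def S.r_distr S.m_lcomm\<close>)
qed

lemma ring_hom_mod_hom:
  assumes "\<phi> \<in> ring_hom A S"
  shows "\<phi> \<in> mod_hom A (restrict_scalars A id) (restrict_scalars S \<phi>)"
  by (rule mod_homI)
    (use assms in \<open>auto simp: restrict_scalars_def ring_hom_closed ring_hom_add ring_hom_mult\<close>)

lemma lc_map_closed:
  fixes I :: "('a, 'm, 'i) coresolution" and J :: "('a, 'n, 'i) coresolution"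
  assumes "ideal m A" "module A M" "module A N"
    and "injective_resolution A M I" "injective_resolution A N J" "f \<in> mod_hom A M N"
    and "\<eta> \<in> carrier (local_cohomology A m I i)"
  shows "lc_map A m M I J i f \<eta> \<in> carrier (local_cohomology A m J i)"
proof -
  obtain F where F: "chain_lift A M I J f F" using chain_lift_exists[OF assms(2,3,6,4,5)] by blast
  obtain z where "z \<in> lc_cycles A m I i" "\<eta> = lc_boundaries A m I i +>\<^bsub>term_at I i\<^esub> z"
    using assms(7) by (auto simp: local_cohomology_simps)
  then show ?thesis
    using lc_map_coset[OF assms(1,4-6) F] chain_lift_cycles[OF assms(1,4,5) F]
    by (auto simp: local_cohomology_simps)
qed

lemma local_cohomology_alg_simps:
  "carrier (local_cohomology_alg A m S \<phi> J i) = carrier (local_cohomology A m J i)"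
  "\<zero>\<^bsub>local_cohomology_alg A m S \<phi> J i\<^esub> = \<zero>\<^bsub>local_cohomology A m J i\<^esub>"
  "s \<odot>\<^bsub>local_cohomology_alg A m S \<phi> J i\<^esub> x =
     lc_map A m (restrict_scalars S \<phi>) J J i (\<lambda>x. s \<otimes>\<^bsub>S\<^esub> x) x"
  by (simp_all add: local_cohomology_alg_def Let_def)

text \<open>Composing lifts of the multiplications by \<open>u\<close> and by \<open>s\<close> gives
  a lift of the multiplication by their product. As any lift computes the induced map, the action is
  multiplicative. These facts allow surplus factors of a product of roots to be discarded.\<close>

lemma local_cohomology_alg_action:
  fixes J :: "('a, 'b, 'i) coresolution" and i :: nat
  assumes "cring A" "cring S" "\<phi> \<in> ring_hom A S" "ideal m A"
    and J: "injective_resolution A (restrict_scalars S \<phi>) J"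
    and s: "s \<in> carrier S"
  defines "H \<equiv> local_cohomology_alg A m S \<phi> J i"
  shows "x \<in> carrier H \<Longrightarrow> s \<odot>\<^bsub>H\<^esub> x \<in> carrier H"
    and "u \<in> carrier S \<Longrightarrow> x \<in> carrier H \<Longrightarrow> (s \<otimes>\<^bsub>S\<^esub> u) \<odot>\<^bsub>H\<^esub> x = s \<odot>\<^bsub>H\<^esub> (u \<odot>\<^bsub>H\<^esub> x)"
    and "s \<odot>\<^bsub>H\<^esub> \<zero>\<^bsub>H\<^esub> = \<zero>\<^bsub>H\<^esub>"
proof -
  interpret S: cring S by fact
  note JD = injective_resolutionD[OF J]
  interpret Ji: module A "term_at J i" by (rule JD(2))
  let ?B = "lc_boundaries A m J i" and ?S = "restrict_scalars S \<phi>"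
  interpret B: additive_subgroup ?B "term_at J i" by (rule lc_boundaries_additive_subgroup[OF J assms(4)])
  note mult = mult_mod_hom[OF assms(2,3)]
  note mod = restrict_scalars_module[OF assms(1-3)]
  have lift: "\<exists>F. chain_lift A ?S J J (\<lambda>x. r \<otimes>\<^bsub>S\<^esub> x) F" if "r \<in> carrier S" for r
    by (rule chain_lift_exists[OF mod mod mult[OF that] J J])
  have act: "r \<odot>\<^bsub>H\<^esub> (?B +>\<^bsub>term_at J i\<^esub> z) = ?B +>\<^bsub>term_at J i\<^esub> F i z"
    if "r \<in> carrier S" "chain_lift A ?S J J (\<lambda>x. r \<otimes>\<^bsub>S\<^esub> x) F" "z \<in> lc_cycles A m J i" for r F z
    using lc_map_coset[OF assms(4) J J mult that(2,3)] that(1)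
    by (simp add: H_def local_cohomology_alg_simps)
  show "s \<odot>\<^bsub>H\<^esub> x \<in> carrier H" if "x \<in> carrier H" for x
    using lc_map_closed[OF assms(4) mod mod J J mult[OF s]] that
    by (simp add: H_def local_cohomology_alg_simps)
  show "(s \<otimes>\<^bsub>S\<^esub> u) \<odot>\<^bsub>H\<^esub> x = s \<odot>\<^bsub>H\<^esub> (u \<odot>\<^bsub>H\<^esub> x)" if u: "u \<in> carrier S" and x: "x \<in> carrier H" for u x
  proof -
    obtain F G where F: "chain_lift A ?S J J (\<lambda>x. s \<otimes>\<^bsub>S\<^esub> x) F"
      and G: "chain_lift A ?S J J (\<lambda>x. u \<otimes>\<^bsub>S\<^esub> x) G" using lift s u by blast
    obtain z where z: "z \<in> lc_cycles A m J i" "x = ?B +>\<^bsub>term_at J i\<^esub> z"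
      using x by (auto simp: H_def local_cohomology_alg_simps local_cohomology_simps)
    have "chain_lift A ?S J J (\<lambda>x. (s \<otimes>\<^bsub>S\<^esub> u) \<otimes>\<^bsub>S\<^esub> x) (\<lambda>n x. F n (G n x))"
      by (rule chain_lift_comp[OF G F]) (use s u in \<open>auto simp: restrict_scalars_def S.m_assoc\<close>)
    then show ?thesis
      using act[OF u G z(1)] act[OF s F chain_lift_cycles[OF assms(4) J J G z(1)]] act z s u by simp
  qed
  obtain F where F: "chain_lift A ?S J J (\<lambda>x. s \<otimes>\<^bsub>S\<^esub> x) F" using lift s by blast
  have J0: "\<zero>\<^bsub>term_at J i\<^esub> \<in> lc_cycles A m J i"
    using additive_subgroup.zero_closed[OF torsion_additive_subgroup[OF JD(2) assms(4)]]
      mod_hom_zero[OF JD(2) JD(2) JD(3)] by (simp add: lc_cycles_def)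
  \<comment> \<open>The zero class is the set of boundaries itself, so it is first rewritten as the
    coset of the zero cycle.\<close>
  have B0: "?B +>\<^bsub>term_at J i\<^esub> \<zero>\<^bsub>term_at J i\<^esub> = ?B"
    using B.a_subset Ji.M.r_zero by (force simp: a_r_coset_def')
  show "s \<odot>\<^bsub>H\<^esub> \<zero>\<^bsub>H\<^esub> = \<zero>\<^bsub>H\<^esub>"
    using act[OF s F J0] mod_hom_zero[OF JD(2) JD(2) chain_liftD(1)[OF F]] B0
    by (simp add: H_def local_cohomology_alg_simps local_cohomology_simps)
qed

section \<open>The roots of p in the base ring\<close>

lemma a_r_coset_mono: "F \<subseteq> G \<Longrightarrow> F +>\<^bsub>R\<^esub> x \<subseteq> G +>\<^bsub>R\<^esub> x"
  by (auto simp: a_r_coset_def')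

text \<open>If \<open>R\<close> is not a ring, it has no ideals and both sides are \<^const>\<open>UNIV\<close>.\<close>

lemma p_filtration_antimono: "p_filtration p R (Suc k) \<subseteq> p_filtration p R k"
proof -
  \<comment> \<open>The ideal generated by an element is the intersection of the ideals containing
    it, and each such ideal brings the ring structure of \<open>R\<close> with it.\<close>
  have "nat_elt R (p ^ Suc k) \<in> I" if "ideal I R" "nat_elt R (p ^ k) \<in> I" for I
  proof -
    interpret ideal I R by fact
    have "nat_elt R (p ^ Suc k) = nat_elt R p \<otimes>\<^bsub>R\<^esub> nat_elt R (p ^ k)"
      by (simp add: nat_elt_def add_pow_ldistr add_pow_rdistr add.nat_pow_pow mult.commute)
    moreover have "nat_elt R p \<in> carrier R" by (simp add: nat_elt_def)
    ultimately show ?thesis using that(2) I_l_closed by simp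
  qed
  then show ?thesis by (auto simp: p_filtration_def genideal_def)
qed

text \<open>The image of one element in the limit. It serves for 0 and 1 in the p-adic integers and
  for the roots of p in \<open>k_circ\<close>.\<close>

lemma limit_ring_constant:
  assumes "x \<in> carrier R" "\<And>k. F (Suc k) \<subseteq> F k"
  shows "(\<lambda>k. F k +>\<^bsub>R\<^esub> x) \<in> carrier (limit_ring R F)"
  using assms a_r_coset_mono[OF assms(2)]
  by (auto simp: limit_ring_def FactRing_def A_RCOSETS_def' a_r_coset_def')

lemma zp_ring_one_zero: "\<one>\<^bsub>zp_ring p\<^esub> \<in> carrier (zp_ring p)" "\<zero>\<^bsub>zp_ring p\<^esub> \<in> carrier (zp_ring p)"
proof -
  let ?F = "p_filtration p \<Z>"
  have F: "ideal (?F k) \<Z>" for k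
    unfolding p_filtration_def by (rule int.genideal_ideal) (simp add: nat_elt_def)
  \<comment> \<open>The zero of a quotient ring is the ideal itself, not a coset written with a
    representative, so the two forms have to be identified.\<close>
  have "(\<lambda>k. ?F k +>\<^bsub>\<Z>\<^esub> \<zero>\<^bsub>\<Z>\<^esub>) = (\<lambda>k. ?F k)"
    using int.a_coset_add_zero ideal.Icarr[OF F] by (force simp: a_r_coset_def')
  then have "(\<lambda>k. ?F k) \<in> carrier (zp_ring p)"
    using limit_ring_constant[where F = ?F and R = \<Z> and x = "\<zero>\<^bsub>\<Z>\<^esub>", OF _ p_filtration_antimono]
    by (simp add: zp_ring_def)
  moreover have "(\<lambda>k. ?F k +>\<^bsub>\<Z>\<^esub> \<one>\<^bsub>\<Z>\<^esub>) \<in> carrier (zp_ring p)"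
    unfolding zp_ring_def by (rule limit_ring_constant) (simp_all add: p_filtration_antimono)
  ultimately show "\<one>\<^bsub>zp_ring p\<^esub> \<in> carrier (zp_ring p)" "\<zero>\<^bsub>zp_ring p\<^esub> \<in> carrier (zp_ring p)"
    by (simp_all add: zp_ring_def limit_ring_def FactRing_def)
qed

text \<open>Almost vanishing is tested by acting with \<open>\<kappa> (p_root p k)\<close>;
  multiplicativity of the action applies to it only once it is known to lie in \<open>S\<close>. The
  monomial has support in a single admissible exponent, and passing to cosets twice keeps it in the
  carrier.\<close>

lemma p_root_in_k_circ: "p_root p k \<in> carrier (k_circ p)"
proof -
  have "1 / of_nat (p ^ k) \<in> perf_exponents p"
    unfolding perf_exponents_def by (rule CollectI, rule exI[of _ 1], rule exI[of _ k]) simp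
  then have "perf_monom (zp_ring p) (1 / of_nat (p ^ k)) \<in> carrier (perf_poly_ring p (zp_ring p))"
    using zp_ring_one_zero
    by (auto simp: perf_monom_def perf_poly_ring_def
        intro: finite_subset[of _ "{1 / of_nat (p ^ k)}"])
  then have "zp_root p k \<in> carrier (zp_roots_ring p)"
    by (auto simp: zp_root_def zp_roots_ring_def FactRing_def A_RCOSETS_def' a_r_coset_def')
  then show ?thesis
    unfolding p_root_def k_circ_def by (rule limit_ring_constant) (rule p_filtration_antimono)
qed

section \<open>Products of roots\<close>

text \<open>The power of a subset in a monoid. Replacing indexed products by set powers turns
  regrouping of factors into arithmetic of exponents.\<close>

primrec products :: "('b, 'd) monoid_scheme \<Rightarrow> 'b set \<Rightarrow> nat \<Rightarrow> 'b set"
  where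
    "products G U 0 = {\<one>\<^bsub>G\<^esub>}"
  | "products G U (Suc a) = U <#>\<^bsub>G\<^esub> products G U a"

context comm_monoid
begin

lemma products_closed: "U \<subseteq> carrier G \<Longrightarrow> products G U a \<subseteq> carrier G"
  by (induction a) (auto simp: set_mult_def)

lemma products_mono: "U \<subseteq> V \<Longrightarrow> products G U a \<subseteq> products G V a"
  by (induction a) (auto simp: set_mult_def)

lemma products_add:
  assumes "U \<subseteq> carrier G"
  shows "products G U (a + b) = products G U a <#> products G U b"
proof (induction a)
  case 0
  then show ?case using products_closed[OF assms, of b] by (force simp: set_mult_def)
next
  case (Suc a)
  have "U <#> (products G U a <#> products G U b) = (U <#> products G U a) <#> products G U b"
  proof -
    have "x \<otimes> (y \<otimes> z) = (x \<otimes> y) \<otimes> z"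
      if "x \<in> U" "y \<in> products G U a" "z \<in> products G U b" for x y z
      using that assms products_closed[OF assms] by (metis m_assoc subsetD)
    then show ?thesis by (fastforce simp: set_mult_def)
  qed
  then show ?case using Suc by simp
qed

lemma products_products:
  assumes "U \<subseteq> carrier G"
  shows "products G (products G U n) a = products G U (n * a)"
  by (induction a) (simp_all add: products_add[OF assms])

lemma pow_in_products: "x \<in> U \<Longrightarrow> U \<subseteq> carrier G \<Longrightarrow> x [^] k \<in> products G U k"
  by (induction k) (auto simp: set_mult_def subset_iff m_comm)

text \<open>Bridge from the indexed products in \<open>diamond_zero\<close> to set powers, by
  splitting off the last factor.\<close>

lemma finprod_image_products:
  assumes "h \<in> \<Lambda> \<rightarrow> carrier G"
  shows "(\<lambda>j. \<Otimes>i\<in>{1..a}. h (j i)) ` ({1..a} \<rightarrow> \<Lambda>) = products G (h ` \<Lambda>) a"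
proof (induction a)
  case 0
  then show ?case by auto
next
  case (Suc a)
  have step: "(\<Otimes>i\<in>{1..Suc a}. h (j i)) = h (j (Suc a)) \<otimes> (\<Otimes>i\<in>{1..a}. h (j i))"
    if "j \<in> {1..Suc a} \<rightarrow> \<Lambda>" for j
    using that assms by (simp add: atLeastAtMostSuc_conv Pi_def)
  show ?case
  proof (intro equalityI subsetI)
    fix g assume "g \<in> (\<lambda>j. \<Otimes>i\<in>{1..Suc a}. h (j i)) ` ({1..Suc a} \<rightarrow> \<Lambda>)"
    then obtain j where j: "j \<in> {1..Suc a} \<rightarrow> \<Lambda>" "g = (\<Otimes>i\<in>{1..Suc a}. h (j i))" by blast
    then have "(\<Otimes>i\<in>{1..a}. h (j i)) \<in> products G (h ` \<Lambda>) a"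
      unfolding Suc.IH[symmetric] by (intro image_eqI[of _ _ j]) auto
    moreover have "j (Suc a) \<in> \<Lambda>" using j(1) by auto
    ultimately show "g \<in> products G (h ` \<Lambda>) (Suc a)"
      using step[OF j(1)] j(2) by (auto simp: set_mult_def)
  next
    fix g assume "g \<in> products G (h ` \<Lambda>) (Suc a)"
    then obtain l q where l: "l \<in> \<Lambda>" "q \<in> products G (h ` \<Lambda>) a" "g = h l \<otimes> q"
      by (auto simp: set_mult_def)
    then obtain j where j: "j \<in> {1..a} \<rightarrow> \<Lambda>" "q = (\<Otimes>i\<in>{1..a}. h (j i))"
      unfolding Suc.IH[symmetric] by blast
    let ?j = "j(Suc a := l)"
    have J: "?j \<in> {1..Suc a} \<rightarrow> \<Lambda>" using j l by auto
    have "(\<Otimes>i\<in>{1..a}. h (?j i)) = q"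
      unfolding j(2) by (rule finprod_cong') (use j assms in auto)
    then have "g = (\<Otimes>i\<in>{1..Suc a}. h (?j i))" using step[OF J] l by simp
    then show "g \<in> (\<lambda>j. \<Otimes>i\<in>{1..Suc a}. h (j i)) ` ({1..Suc a} \<rightarrow> \<Lambda>)" using J by blast
  qed
qed

text \<open>The extra factor is spread over the whole index range as a product that is 1 away from
  \<open>i\<close>.\<close>

lemma finprod_increment_exponent:
  assumes h: "h \<in> {1..r} \<rightarrow> carrier G" and i: "i \<in> {1..r::nat}"
  shows "(\<Otimes>k\<in>{1..r}. h k [^] (\<beta>(i := Suc (\<beta> i))) k) = h i \<otimes> (\<Otimes>k\<in>{1..r}. h k [^] (\<beta> k :: nat))"
proof -
  have "(\<Otimes>k\<in>{1..r}. h k [^] (\<beta>(i := Suc (\<beta> i))) k) =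
      (\<Otimes>k\<in>{1..r}. (if i = k then h k else \<one>) \<otimes> h k [^] \<beta> k)"
    by (rule finprod_cong') (use h in \<open>auto simp: m_comm Pi_iff\<close>)
  also have "\<dots> = (\<Otimes>k\<in>{1..r}. if i = k then h k else \<one>) \<otimes> (\<Otimes>k\<in>{1..r}. h k [^] \<beta> k)"
    by (rule finprod_multf) (use h in auto)
  also have "(\<Otimes>k\<in>{1..r}. if i = k then h k else \<one>) = h i"
    by (rule finprod_singleton) (use h i in auto)
  finally show ?thesis .
qed

text \<open>Induction on the degree: a monomial of positive degree has a positive exponent, which
  can be lowered by one, and conversely multiplying by one generator raises one exponent.\<close>

lemma monomials_products:
  assumes h: "h \<in> {1..r} \<rightarrow> carrier G"
  shows "(\<lambda>\<alpha>. \<Otimes>i\<in>{1..r}. h i [^] \<alpha> i) ` monomial_exponents r n = products G (h ` {1..r}) n"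
proof (induction n)
  case 0
  have "monomial_exponents r 0 = {\<lambda>_. 0}" by (fastforce simp: monomial_exponents_def)
  then show ?case by simp
next
  case (Suc n)
  have sum: "(\<Sum>k\<in>{1..r}. (\<beta>(i := Suc (\<beta> i))) k) = Suc (\<Sum>k\<in>{1..r}. \<beta> k)"
    if "i \<in> {1..r}" for \<beta> :: "nat \<Rightarrow> nat" and i
    using that by (simp add: sum.remove[of _ i])
  show ?case
  proof (intro equalityI subsetI)
    fix g assume "g \<in> (\<lambda>\<alpha>. \<Otimes>i\<in>{1..r}. h i [^] \<alpha> i) ` monomial_exponents r (Suc n)"
    then obtain \<alpha> where \<alpha>: "\<alpha> \<in> monomial_exponents r (Suc n)" "g = (\<Otimes>i\<in>{1..r}. h i [^] \<alpha> i)"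
      by blast
    then obtain i where i: "i \<in> {1..r}" "\<alpha> i \<noteq> 0"
      by (metis (mono_tags, lifting) monomial_exponents_def mem_Collect_eq nat.distinct(1) sum.neutral)
    define \<beta> where "\<beta> = \<alpha>(i := \<alpha> i - 1)"
    have ab: "\<alpha> = \<beta>(i := Suc (\<beta> i))" using i by (auto simp: \<beta>_def)
    have "(\<Sum>k\<in>{1..r}. \<beta> k) = n"
      using \<alpha>(1) sum[OF i(1), of \<beta>] unfolding ab[symmetric] by (simp add: monomial_exponents_def)
    then have "\<beta> \<in> monomial_exponents r n"
      using \<alpha>(1) by (auto simp: monomial_exponents_def \<beta>_def)
    then have "(\<Otimes>k\<in>{1..r}. h k [^] \<beta> k) \<in> products G (h ` {1..r}) n"
      unfolding Suc.IH[symmetric] by blast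
    moreover have "g = h i \<otimes> (\<Otimes>k\<in>{1..r}. h k [^] \<beta> k)"
      using \<alpha>(2) finprod_increment_exponent[OF h i(1), of \<beta>] ab by simp
    ultimately show "g \<in> products G (h ` {1..r}) (Suc n)"
      using i(1) by (auto simp: set_mult_def)
  next
    fix g assume "g \<in> products G (h ` {1..r}) (Suc n)"
    then obtain i q where i: "i \<in> {1..r}" "q \<in> products G (h ` {1..r}) n" "g = h i \<otimes> q"
      by (auto simp: set_mult_def)
    then obtain \<beta> where \<beta>: "\<beta> \<in> monomial_exponents r n" "q = (\<Otimes>k\<in>{1..r}. h k [^] \<beta> k)"
      unfolding Suc.IH[symmetric] by blast
    have "\<beta>(i := Suc (\<beta> i)) \<in> monomial_exponents r (Suc n)"
      using \<beta>(1) i(1) sum[OF i(1), of \<beta>] by (simp add: monomial_exponents_def)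
    moreover have "g = (\<Otimes>k\<in>{1..r}. h k [^] (\<beta>(i := Suc (\<beta> i))) k)"
      using finprod_increment_exponent[OF h i(1), of \<beta>] i(3) \<beta>(2) by simp
    ultimately show "g \<in> (\<lambda>\<alpha>. \<Otimes>i\<in>{1..r}. h i [^] \<alpha> i) ` monomial_exponents r (Suc n)" by blast
  qed
qed

text \<open>Each root is the p-th power of the root one level up, so one refinement multiplies the
  number of factors by p.\<close>

lemma products_refine:
  assumes "\<And>l e. l \<in> \<Lambda> \<Longrightarrow> \<rho> l e \<in> carrier G" "\<And>l e. l \<in> \<Lambda> \<Longrightarrow> \<rho> l (Suc e) [^] (p::nat) = \<rho> l e"
  shows "products G ((\<lambda>l. \<rho> l e) ` \<Lambda>) a \<subseteq> products G ((\<lambda>l. \<rho> l (e + k)) ` \<Lambda>) (a * p ^ k)"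
proof (induction k)
  case (Suc k)
  let ?U = "\<lambda>k. (\<lambda>l. \<rho> l (e + k)) ` \<Lambda>"
  have U: "?U k \<subseteq> carrier G" for k using assms(1) by auto
  have "?U k \<subseteq> products G (?U (Suc k)) p"
  proof
    fix x assume "x \<in> ?U k"
    then obtain l where l: "l \<in> \<Lambda>" "x = \<rho> l (e + k)" by blast
    then have "x = \<rho> l (e + Suc k) [^] p" by (simp add: assms(2))
    then show "x \<in> products G (?U (Suc k)) p" using pow_in_products[OF _ U] l(1) by blast
  qed
  then have "products G (?U k) (a * p ^ k) \<subseteq> products G (?U (Suc k)) (p * (a * p ^ k))"
    using products_mono products_products[OF U] by metis
  then show ?case using Suc by (simp add: mult_ac)
qed simp

end

section \<open>Comparison of the test ideals\<close>

lemma diamond_zero_iff: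
  assumes "cring S" "\<And>e. (\<lambda>l. \<rho> l e) \<in> \<Lambda> \<rightarrow> carrier S"
  shows "\<eta> \<in> diamond_zero p A m d S \<kappa> \<phi> I J \<Lambda> \<rho> t \<longleftrightarrow>
    \<eta> \<in> carrier (local_cohomology A m I d) \<and>
    (\<forall>e>0. \<forall>a::nat. real a \<ge> t * real p ^ e \<longrightarrow>
      (\<forall>g\<in>products S ((\<lambda>l. \<rho> l e) ` \<Lambda>) a.
        almost_zero_elt p \<kappa> (local_cohomology_alg A m S \<phi> J d)
          (g \<odot>\<^bsub>local_cohomology_alg A m S \<phi> J d\<^esub> lc_map A m (restrict_scalars A id) I J d \<phi> \<eta>)))"
proof -
  interpret cring S by fact
  have "products S ((\<lambda>l. \<rho> l e) ` \<Lambda>) a = (\<lambda>j. \<Otimes>\<^bsub>S\<^esub>i\<in>{1..a}. \<rho> (j i) e) ` ({1..a} \<rightarrow> \<Lambda>)" for e a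
    by (rule finprod_image_products[symmetric]) (use assms(2) in auto)
  then show ?thesis unfolding diamond_zero_def Let_def by auto
qed

lemma monomial_roots_image:
  assumes "cring S" "\<And>e. (\<lambda>i. \<rho> i e) \<in> {1..r} \<rightarrow> carrier S"
  shows "(\<lambda>\<alpha>. monomial_roots S r \<rho> \<alpha> e) ` monomial_exponents r n =
    products S ((\<lambda>i. \<rho> i e) ` {1..r}) n"
proof -
  interpret cring S by fact
  show ?thesis unfolding monomial_roots_def by (rule monomials_products) (use assms(2) in auto)
qed

text \<open>Exponents multiply when a set power is raised to a power, so the monomials enter only
  through the factor \<open>n\<close>.\<close>

lemma products_monomial_roots:
  assumes "cring S" "\<And>e. (\<lambda>i. \<rho> i e) \<in> {1..r} \<rightarrow> carrier S"
  shows "products S ((\<lambda>\<alpha>. monomial_roots S r \<rho> \<alpha> e) ` monomial_exponents r n) a =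
    products S ((\<lambda>i. \<rho> i e) ` {1..r}) (n * a)"
proof -
  interpret cring S by fact
  show ?thesis
    unfolding monomial_roots_image[where \<rho> = \<rho>, OF assms]
    by (rule products_products) (use assms(2) in auto)
qed

lemma monomial_roots_closed:
  assumes "cring S" "\<And>e. (\<lambda>i. \<rho> i e) \<in> {1..r} \<rightarrow> carrier S"
  shows "(\<lambda>\<alpha>. monomial_roots S r \<rho> \<alpha> e) \<in> \<Lambda> \<rightarrow> carrier S"
proof -
  interpret cring S by fact
  have "monomial_roots S r \<rho> \<alpha> e \<in> carrier S" for \<alpha>
    unfolding monomial_roots_def by (rule finprod_closed) (use assms(2) in auto)
  then show ?thesis by blast
qed

text \<open>The condition on \<open>a\<close> monomial roots is the condition on
  \<open>n * a\<close> generator roots at the same level, and the numerical bound scales by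
  \<open>n\<close> as well.\<close>

lemma diamond_zero_monomials_supset:
  assumes "cring S" "\<And>e. (\<lambda>i. \<rho> i e) \<in> {1..r} \<rightarrow> carrier S"
  shows "diamond_zero p A m d S \<kappa> \<phi> I J {1..r} \<rho> (real n * t) \<subseteq>
    diamond_zero p A m d S \<kappa> \<phi> I J (monomial_exponents r n) (monomial_roots S r \<rho>) t"
proof
  fix \<eta> assume "\<eta> \<in> diamond_zero p A m d S \<kappa> \<phi> I J {1..r} \<rho> (real n * t)"
  note \<eta> = this[unfolded diamond_zero_iff[where \<rho> = \<rho>, OF assms]]
  show "\<eta> \<in> diamond_zero p A m d S \<kappa> \<phi> I J (monomial_exponents r n) (monomial_roots S r \<rho>) t"
    unfolding diamond_zero_iff[OF assms(1) monomial_roots_closed[where \<rho> = \<rho>, OF assms]]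
  proof (intro conjI allI impI)
    fix e a :: nat assume e: "e > 0" and a: "t * real p ^ e \<le> real a"
    have "real n * t * real p ^ e \<le> real (n * a)"
      using mult_left_mono[OF a, of "real n"] by (simp add: mult.assoc)
    then show "\<forall>g\<in>products S ((\<lambda>\<alpha>. monomial_roots S r \<rho> \<alpha> e) ` monomial_exponents r n) a.
        almost_zero_elt p \<kappa> (local_cohomology_alg A m S \<phi> J d)
          (g \<odot>\<^bsub>local_cohomology_alg A m S \<phi> J d\<^esub> lc_map A m (restrict_scalars A id) I J d \<phi> \<eta>)"
      unfolding products_monomial_roots[where \<rho> = \<rho>, OF assms] using \<eta> e by blast
  qed (use \<eta> in blast)
qed

text \<open>A product of \<open>b\<close> roots of level \<open>e\<close> is one of \<open>b p\<^sup>k\<close> roots of level \<open>e + k\<close>. Grouping the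
  latter into monomials of degree \<open>n\<close> leaves fewer than \<open>n\<close> factors over, and for large \<open>k\<close> this
  loss is absorbed by the gap between the two exponents.\<close>

lemma diamond_zero_monomials_subset:
  fixes I :: "('a, 'a, 'i) coresolution" and J :: "('a, 'b, 'i) coresolution"
  assumes A: "cring A" and S: "cring S" and \<phi>: "\<phi> \<in> ring_hom A S" and m: "ideal m A"
    and \<kappa>: "\<kappa> \<in> ring_hom (k_circ p) S"
    and I: "injective_resolution A (restrict_scalars A id) I"
    and J: "injective_resolution A (restrict_scalars S \<phi>) J"
    and \<rho>: "\<And>e. (\<lambda>i. \<rho> i e) \<in> {1..r} \<rightarrow> carrier S"
    and root: "\<And>i e. i \<in> {1..r} \<Longrightarrow> \<rho> i (Suc e) [^]\<^bsub>S\<^esub> p = \<rho> i e"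
    and p: "p > 1" and n: "n > 0" and lt: "s < t"
  shows "diamond_zero p A m d S \<kappa> \<phi> I J (monomial_exponents r n) (monomial_roots S r \<rho>) s \<subseteq>
    diamond_zero p A m d S \<kappa> \<phi> I J {1..r} \<rho> (real n * t)"
proof
  interpret cring S by fact
  define H where "H = local_cohomology_alg A m S \<phi> J d"
  note action = local_cohomology_alg_action[OF A S \<phi> m J, where i = d, folded H_def]
  fix \<eta> assume "\<eta> \<in> diamond_zero p A m d S \<kappa> \<phi> I J (monomial_exponents r n) (monomial_roots S r \<rho>) s"
  note \<eta> = this[unfolded diamond_zero_iff[OF S monomial_roots_closed[where \<rho> = \<rho>, OF S \<rho>]]
      products_monomial_roots[where \<rho> = \<rho>, OF S \<rho>], folded H_def]
  define x where "x = lc_map A m (restrict_scalars A id) I J d \<phi> \<eta>"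
  have x: "x \<in> carrier H"
  proof -
    have id: "id \<in> ring_hom A A" by (simp add: ring_hom_def)
    show ?thesis
      unfolding H_def local_cohomology_alg_simps x_def
      using lc_map_closed[OF m restrict_scalars_module[OF A A id] restrict_scalars_module[OF A S \<phi>]
          I J ring_hom_mod_hom[OF \<phi>]] \<eta> by blast
  qed
  show "\<eta> \<in> diamond_zero p A m d S \<kappa> \<phi> I J {1..r} \<rho> (real n * t)"
    unfolding diamond_zero_iff[where \<rho> = \<rho>, OF S \<rho>] H_def[symmetric] x_def[symmetric]
  proof (intro conjI allI impI ballI)
    let ?U = "\<lambda>e. (\<lambda>i. \<rho> i e) ` {1..r}"
    have U: "?U e \<subseteq> carrier S" for e using \<rho> by auto
    fix e b g assume e: "e > 0" and b: "real n * t * real p ^ e \<le> real b"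
      and g: "g \<in> products S (?U e) b"
    \<comment> \<open>\<open>k\<close> is chosen so that at level \<open>e + k\<close> the gap
      between the exponents \<open>s\<close> and \<open>t\<close> is worth more than one
      monomial.\<close>
    obtain k where k: "1 / (t - s) < real p ^ k"
      using real_arch_pow[of "real p"] p by auto
    define E where "E = e + k"
    define q where "q = (b * p ^ k) div n"
    define rem where "rem = (b * p ^ k) mod n"
    have "real p ^ k \<le> real p ^ E" using p by (intro power_increasing) (auto simp: E_def)
    with k have "1 / (t - s) < real p ^ E" by simp
    then have gap: "1 < (t - s) * real p ^ E" using lt by (simp add: divide_simps mult.commute)
    \<comment> \<open>Since the remainder is below \<open>n\<close>, rounding down to full monomials
      loses less than one of them: \<open>q + 1\<close> exceeds \<open>t * p ^ E\<close>. The gap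
      then pays for the missing 1.\<close>
    have "real n * t * real p ^ E = (real n * t * real p ^ e) * real p ^ k"
      by (simp add: E_def power_add)
    also have "\<dots> \<le> real b * real p ^ k" using b by (intro mult_right_mono) auto
    also have "\<dots> = real (n * q + rem)" unfolding q_def rem_def by simp
    also have "\<dots> < real (n * q) + real n" using n by (simp add: rem_def)
    finally have "real n * (t * real p ^ E) < real n * (real q + 1)" by (simp add: algebra_simps)
    then have "t * real p ^ E < real q + 1" using n by simp
    then have q: "s * real p ^ E \<le> real q" using gap by (simp add: algebra_simps)
    have "g \<in> products S (?U E) (b * p ^ k)"
      unfolding E_def using g products_refine[of "{1..r}" \<rho> p, OF funcset_mem[OF \<rho>] root] by blast
    then have "g \<in> products S (?U E) (n * q + rem)" by (simp add: q_def rem_def)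
    then obtain v u where vu: "v \<in> products S (?U E) (n * q)" "u \<in> products S (?U E) rem"
      "g = v \<otimes>\<^bsub>S\<^esub> u"
      unfolding products_add[OF U] by (auto simp: set_mult_def)
    have cl: "v \<in> carrier S" "u \<in> carrier S" using vu products_closed[OF U] by auto
    have "E > 0" using e by (simp add: E_def)
    then have v: "almost_zero_elt p \<kappa> H (v \<odot>\<^bsub>H\<^esub> x)"
      using \<eta> q vu(1) unfolding x_def by blast
    show "almost_zero_elt p \<kappa> H (g \<odot>\<^bsub>H\<^esub> x)"
      unfolding almost_zero_elt_def
    proof (intro allI impI)
      fix j :: nat assume "j > 0"
      let ?c = "\<kappa> (p_root p j)"
      have c: "?c \<in> carrier S" using ring_hom_closed[OF \<kappa> p_root_in_k_circ] .
      \<comment> \<open>The leftover factor \<open>u\<close> is commuted to the outside, where it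
        acts on an element that is already zero.\<close>
      have "?c \<odot>\<^bsub>H\<^esub> (g \<odot>\<^bsub>H\<^esub> x) = (?c \<otimes>\<^bsub>S\<^esub> g) \<odot>\<^bsub>H\<^esub> x"
        using action(2) c cl vu(3) x by simp
      also have "?c \<otimes>\<^bsub>S\<^esub> g = u \<otimes>\<^bsub>S\<^esub> (?c \<otimes>\<^bsub>S\<^esub> v)"
        using c cl by (simp add: vu(3) m_ac)
      also have "\<dots> \<odot>\<^bsub>H\<^esub> x = u \<odot>\<^bsub>H\<^esub> (?c \<odot>\<^bsub>H\<^esub> (v \<odot>\<^bsub>H\<^esub> x))"
        using action(2) c cl x by simp
      also have "\<dots> = \<zero>\<^bsub>H\<^esub>"
        using v \<open>j > 0\<close> action(3)[OF cl(2)] by (simp add: almost_zero_elt_def)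
      finally show "?c \<odot>\<^bsub>H\<^esub> (g \<odot>\<^bsub>H\<^esub> x) = \<zero>\<^bsub>H\<^esub>" .
    qed
  qed (use \<eta> in blast)
qed

section \<open>Passage to the right limit in the exponent\<close>

lemma annihilator_antimono: "N \<subseteq> N' \<Longrightarrow> annihilator R M N' \<subseteq> annihilator R M N"
  by (auto simp: annihilator_def)

text \<open>Just to the right of the base point, each family is squeezed between two values of the
  other, so constancy passes both ways. Proving the equivalence for each \<open>b\<close> makes the
  defining predicates of the two definite descriptions in \<open>tau\<close> agree.\<close>

lemma right_limit_scaling:
  fixes F G :: "real \<Rightarrow> 'x set" and c t :: real
  assumes c: "c > 0" and FG: "\<And>s. F s \<subseteq> G (c * s)" and GF: "\<And>s u. s < u \<Longrightarrow> G (c * u) \<subseteq> F s"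
  shows "(\<exists>\<epsilon>\<^sub>0>0. \<forall>\<epsilon>. 0 < \<epsilon> \<and> \<epsilon> < \<epsilon>\<^sub>0 \<longrightarrow> F (t + \<epsilon>) = b) \<longleftrightarrow>
    (\<exists>\<epsilon>\<^sub>0>0. \<forall>\<epsilon>. 0 < \<epsilon> \<and> \<epsilon> < \<epsilon>\<^sub>0 \<longrightarrow> G (c * t + \<epsilon>) = b)"
proof
  assume "\<exists>\<epsilon>\<^sub>0>0. \<forall>\<epsilon>. 0 < \<epsilon> \<and> \<epsilon> < \<epsilon>\<^sub>0 \<longrightarrow> F (t + \<epsilon>) = b"
  then obtain \<epsilon>\<^sub>0 where 0: "\<epsilon>\<^sub>0 > 0" "\<And>\<epsilon>. 0 < \<epsilon> \<Longrightarrow> \<epsilon> < \<epsilon>\<^sub>0 \<Longrightarrow> F (t + \<epsilon>) = b" by blast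
  have "G (c * t + \<epsilon>) = b" if "0 < \<epsilon>" "\<epsilon> < c * \<epsilon>\<^sub>0" for \<epsilon>
  proof -
    have "0 < \<epsilon> / c" "\<epsilon> / c < \<epsilon>\<^sub>0" using that c by (auto simp: divide_simps mult.commute)
    \<comment> \<open>The halfway point supplies the strictly smaller argument required by
      \<open>GF\<close>.\<close>
    then have b: "F (t + \<epsilon> / c) = b" "F (t + \<epsilon> / c / 2) = b" using 0 by auto
    have "c * (t + \<epsilon> / c) = c * t + \<epsilon>" using c by (simp add: field_simps)
    moreover have "t + \<epsilon> / c / 2 < t + \<epsilon> / c" using \<open>0 < \<epsilon> / c\<close> by simp
    ultimately show ?thesis using FG[of "t + \<epsilon> / c"] GF[of "t + \<epsilon> / c / 2" "t + \<epsilon> / c"] b by simp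
  qed
  then show "\<exists>\<epsilon>\<^sub>0>0. \<forall>\<epsilon>. 0 < \<epsilon> \<and> \<epsilon> < \<epsilon>\<^sub>0 \<longrightarrow> G (c * t + \<epsilon>) = b"
    using 0(1) c by (intro exI[of _ "c * \<epsilon>\<^sub>0"]) auto
next
  assume "\<exists>\<epsilon>\<^sub>0>0. \<forall>\<epsilon>. 0 < \<epsilon> \<and> \<epsilon> < \<epsilon>\<^sub>0 \<longrightarrow> G (c * t + \<epsilon>) = b"
  then obtain \<epsilon>\<^sub>0 where 0: "\<epsilon>\<^sub>0 > 0" "\<And>\<epsilon>. 0 < \<epsilon> \<Longrightarrow> \<epsilon> < \<epsilon>\<^sub>0 \<Longrightarrow> G (c * t + \<epsilon>) = b" by blast
  \<comment> \<open>The factor 2 in the bound leaves room for the larger argument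
    \<open>t + 2 * \<epsilon>\<close>, at which \<open>G\<close> must still take the value
    \<open>b\<close>.\<close>
  have "F (t + \<epsilon>) = b" if "0 < \<epsilon>" "\<epsilon> < \<epsilon>\<^sub>0 / (2 * c)" for \<epsilon>
  proof -
    have "0 < c * \<epsilon>" "c * \<epsilon> < \<epsilon>\<^sub>0" "0 < c * (2 * \<epsilon>)" "c * (2 * \<epsilon>) < \<epsilon>\<^sub>0"
      using that c 0(1) by (auto simp: divide_simps mult_ac)
    then have "G (c * (t + \<epsilon>)) = b" "G (c * (t + 2 * \<epsilon>)) = b"
      using 0(2) by (metis distrib_left)+
    then show ?thesis using FG[of "t + \<epsilon>"] GF[of "t + \<epsilon>" "t + 2 * \<epsilon>"] that(1) by auto
  qed
  then show "\<exists>\<epsilon>\<^sub>0>0. \<forall>\<epsilon>. 0 < \<epsilon> \<and> \<epsilon> < \<epsilon>\<^sub>0 \<longrightarrow> F (t + \<epsilon>) = b"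
    using 0(1) c by (intro exI[of _ "\<epsilon>\<^sub>0 / (2 * c)"]) auto
qed

theorem proposition3p8:
  fixes A :: "'a ring" and S :: "'b ring" and m :: "'a set" and p d r n :: nat and t :: real
    and \<kappa> :: "k_circ_elt \<Rightarrow> 'b" and \<phi> :: "'a \<Rightarrow> 'b"
    and I :: "('a, 'a, 'i) coresolution" and J :: "('a, 'b, 'i) coresolution"
    and f :: "nat \<Rightarrow> 'a" and \<rho> :: "nat \<Rightarrow> nat \<Rightarrow> 'b" and \<aa> :: "'a set"
  assumes "Factorial_Ring.prime p"
    and "complete_regular_local_mixed p A m d"
    and "integral_perfectoid p S \<kappa>"
    and "\<phi> \<in> ring_hom A S"
    and "\<forall>g\<in>carrier A. \<exists>\<sigma>. compatible_roots p S (\<phi> g) \<sigma>"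
    and "almost_flat p A S \<kappa> \<phi>"
    and "almost_faithful p A S \<kappa> \<phi>"
    and "injective_resolution A (restrict_scalars A id) I"
    and "injective_resolution A (restrict_scalars S \<phi>) J"
    and "\<forall>i\<in>{1..r}. f i \<in> carrier A"
    and "\<aa> = Idl\<^bsub>A\<^esub> (f ` {1..r})"
    and "\<forall>i\<in>{1..r}. compatible_roots p S (\<phi> (f i)) (\<rho> i)"
    and "n > 0" and "t \<ge> 0"
  shows "tau p A m d S \<kappa> \<phi> I J (monomial_exponents r n) (monomial_roots S r \<rho>) t
       = tau p A m d S \<kappa> \<phi> I J {1..r} \<rho> (real n * t)"
proof -
  have A: "cring A" and m: "ideal m A"
    using assms(2) by (auto simp: complete_regular_local_mixed_def regular_local_ring_def
        local_ring_def maximalideal.axioms(1))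
  have S: "cring S" and \<kappa>: "\<kappa> \<in> ring_hom (k_circ p) S"
    using assms(3) by (auto simp: integral_perfectoid_def)
  have \<rho>: "\<And>e. (\<lambda>i. \<rho> i e) \<in> {1..r} \<rightarrow> carrier S"
    and root: "\<And>i e. i \<in> {1..r} \<Longrightarrow> \<rho> i (Suc e) [^]\<^bsub>S\<^esub> p = \<rho> i e"
    using assms(12) by (auto simp: compatible_roots_def)
  let ?mon = "tau_sharp p A m d S \<kappa> \<phi> I J (monomial_exponents r n) (monomial_roots S r \<rho>)"
  let ?gen = "tau_sharp p A m d S \<kappa> \<phi> I J {1..r} \<rho>"
  \<comment> \<open>Annihilators reverse the inclusions between the \<open>diamond_zero\<close>
    sets, giving the two comparisons that \<open>right_limit_scaling\<close> requires.\<close>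
  have "?mon s \<subseteq> ?gen (real n * s)" for s
    unfolding tau_sharp_def
    by (intro annihilator_antimono diamond_zero_monomials_supset[where \<rho> = \<rho>, OF S \<rho>])
  moreover have "?gen (real n * u) \<subseteq> ?mon s" if "s < u" for s u
    unfolding tau_sharp_def
    by (intro annihilator_antimono diamond_zero_monomials_subset[where \<rho> = \<rho>,
          OF A S assms(4) m \<kappa> assms(8,9) \<rho> root prime_gt_1_nat[OF assms(1)] assms(13) that])
  ultimately show ?thesis
    unfolding tau_def using assms(13) by (subst right_limit_scaling[of "real n" ?mon ?gen]) simp_all
qed

end
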